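(* Let $\omega$ be a weight. Let $f$ be a critical polynomial all of whose zeros are simple, and for each $n\in\mathbb{N}$ let $p_n$ be the $n$-th optimal polynomial approximant to $1/f$ in $H^2_\omega$. Then there exists a subsequence $\{n_k\}_{k\in\mathbb{N}}\subset\mathbb{N}$ such that the zeros of $\{1-p_{n_k}f\}_{k\in\mathbb{N}}$ are asymptotically equidistributed on the unit circle $\mathbb{T}$, i.e. the measures $\mu_{1-p_{n_k}f}$ converge weakly, as $k\to\infty$, to the uniform measure $\nu_{\mathbb{T}}$ on $\mathbb{T}$.
   Context: $\mathbb{N}=\{0,1,2,\dots\}$, $\mathbb{D}=\{z\in\mathbb{C}:|z|<1\}$, $\mathbb{T}=\{z\in\mathbb{C}:|z|=1\}$. A weight is a monotone (nondecreasing or nonincreasing) sequence $\omega=\{\omega_k\}_{k\in\mathbb{N}}$ of positive reals with $\omega_0=1$, $\lim_{n\to\infty}\omega_n/\omega_{n-\lfloor\sqrt n\rfloor}=1$, and $\sum_{k=1}^\infty 1/\omega_k=+\infty$. $H^2_\omega$ is the Hilbert space of holomorphic functions $g(z)=\sum_{k\ge0}a_kz^k$ on $\mathbb{D}$ with $\|g\|_\omega^2=\sum_{k\ge0}|a_k|^2\omega_k<\infty$. $\mathcal{P}_n$ is the space of complex polynomials of degree at most $n$. For $f\in H^2_\omega$ not identically zero, the $n$-th optimal polynomial approximant (o.p.a.) to $1/f$ in $H^2_\omega$ is the unique $p_n\in\mathcal{P}_n$ such that $\|1-p_nf\|_\omega\le\|1-qf\|_\omega$ for all $q\in\mathcal{P}_n$.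 A polynomial $f$ is critical if it has no zeros in $\mathbb{D}$ but has at least one zero on $\mathbb{T}$. For a polynomial $q$ of degree $m\ge1$, $\mu_q=\frac1m\sum_{j}\delta_{z_j}$, the sum being over the zeros $z_j$ of $q$ in $\mathbb{C}$ counted with multiplicity; $\nu_{\mathbb{T}}$ is normalized arc length measure on $\mathbb{T}$. *)

theory Defs
  imports
    "HOL-Complex_Analysis.Complex_Analysis"
    "HOL-Probability.Probability"
begin

definition is_weight :: "(nat \<Rightarrow> real) \<Rightarrow> bool" where
  "is_weight \<omega> \<longleftrightarrow>
     (mono \<omega> \<or> antimono \<omega>) \<and>
     (\<forall>k. \<omega> k > 0) \<and>
     \<omega> 0 = 1 \<and>
     (\<lambda>n. \<omega> n / \<omega> (n - nat \<lfloor>sqrt (real n)\<rfloor>)) \<longlonglongrightarrow> 1 \<and>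
     filterlim (\<lambda>n. \<Sum>k=1..n. 1 / \<omega> k) at_top sequentially"

abbreviation taylor_coeff :: "(complex \<Rightarrow> complex) \<Rightarrow> nat \<Rightarrow> complex" where
  "taylor_coeff g k \<equiv> fps_nth (fps_expansion g 0) k"

text \<open>An element of the space is represented by any function on the whole plane that agrees with
  it on the open unit disc; the norm depends only on the values there.\<close>

definition H2 :: "(nat \<Rightarrow> real) \<Rightarrow> (complex \<Rightarrow> complex) set" where
  "H2 \<omega> = {g. g holomorphic_on ball 0 1 \<and>
              summable (\<lambda>k. (cmod (taylor_coeff g k))\<^sup>2 * \<omega> k)}"

definition H2_norm :: "(nat \<Rightarrow> real) \<Rightarrow> (complex \<Rightarrow> complex) \<Rightarrow> real" where
  "H2_norm \<omega> g = sqrt (\<Sum>k. (cmod (taylor_coeff g k))\<^sup>2 * \<omega> k)"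

text \<open>\<open>p\<close> is the \<open>n\<close>-th optimal polynomial approximant to \<open>1/f\<close>. For a weight \<open>\<omega>\<close>, the space is
  closed under multiplication by polynomials, so all the norms below are sums of convergent
  series.\<close>

definition is_opa :: "(nat \<Rightarrow> real) \<Rightarrow> (complex \<Rightarrow> complex) \<Rightarrow> nat \<Rightarrow> complex poly \<Rightarrow> bool" where
  "is_opa \<omega> f n p \<longleftrightarrow>
     f \<in> H2 \<omega> \<and> (\<exists>z\<in>ball 0 1. f z \<noteq> 0) \<and>
     degree p \<le> n \<and>
     (\<forall>q. degree q \<le> n \<longrightarrow>
        H2_norm \<omega> (\<lambda>z. 1 - poly p z * f z) \<le> H2_norm \<omega> (\<lambda>z. 1 - poly q z * f z))"

definition critical :: "complex poly \<Rightarrow> bool" where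
  "critical f \<longleftrightarrow>
     (\<forall>z\<in>ball 0 1. poly f z \<noteq> 0) \<and> (\<exists>z\<in>sphere 0 1. poly f z = 0)"

text \<open>A zero \<open>z\<close> of \<open>q\<close> carries mass \<open>order z q / degree q\<close>, where \<open>order\<close> is the multiplicity.
  The pushforward along the identity only makes the result a Borel measure. For constant \<open>q\<close>
  this is the null measure.\<close>

definition zero_measure :: "complex poly \<Rightarrow> complex measure" where
  "zero_measure q =
     distr (point_measure {z. poly q z = 0} (\<lambda>z. ennreal (real (order z q) / real (degree q))))
       borel (\<lambda>z. z)"

definition circle_measure :: "complex measure" where
  "circle_measure = distr (uniform_measure lborel {0..2 * pi}) borel cis"

definition weakly_converges :: "(nat \<Rightarrow> complex measure) \<Rightarrow> complex measure \<Rightarrow> bool" where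
  "weakly_converges M N \<longleftrightarrow>
     (\<forall>g :: complex \<Rightarrow> real. continuous_on UNIV g \<and> bounded (range g) \<longrightarrow>
        (\<lambda>k. integral\<^sup>L (M k) g) \<longlonglongrightarrow> integral\<^sup>L N g)"

end

theory Submission
  imports Defs
    "HOL-Computational_Algebra.Fundamental_Theorem_Algebra"
    "HOL-Real_Asymp.Real_Asymp"
begin

text \<open>
  By a Jentzsch--Szego type theorem, the zeros of polynomials of degree \<open>N \<rightarrow> \<infinity>\<close> equidistribute on
  the circle as soon as the constant coefficient, the leading coefficient and the maximum on the
  circle are all \<open>exp (o(N))\<close>. To see this, reflect the zeros inside the disc: the resulting
  polynomial \<open>\<Prod>(1 - x\<^sub>i z)\<close> has a logarithm in the disc with real part at most \<open>o(N)\<close>, so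
  Borel--Caratheodory makes its Taylor coefficients, which are the power sums of the \<open>x\<^sub>i\<close>, of
  size \<open>o(N)\<close>.

  For \<open>R\<^sub>n = 1 - p\<^sub>n f\<close> the constant coefficient is at least \<open>\<rho>\<^sub>n\<^sup>2\<close>, where \<open>\<rho>\<^sub>n\<close> is the norm of
  \<open>R\<^sub>n\<close>, and \<open>\<rho>\<^sub>n\<close> is not exponentially small because \<open>R\<^sub>n = 1\<close> at a zero of \<open>f\<close> on the circle.
  The decrement \<open>\<rho>\<^sub>n - \<rho>\<^sub>n\<^sub>+\<^sub>1\<close> is at most the leading coefficient of \<open>R\<^sub>n\<^sub>+\<^sub>1\<close> times a subexponential
  factor, and \<open>\<rho>\<^sub>n \<rightarrow> 0\<close>; if all leading coefficients were exponentially small, then \<open>\<rho>\<^sub>n\<close> would be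
  too. Hence along a subsequence the leading coefficients are not exponentially small.
\<close>

section \<open>Zeros of polynomials with moderate coefficients\<close>

lemma sum_list_map_eq_sum_count_real:
  fixes g :: "'a \<Rightarrow> real"
  assumes "finite A" "set xs \<subseteq> A"
  shows "sum_list (map g xs) = (\<Sum>z\<in>A. real (count_list xs z) * g z)"
  using assms(2)
proof (induction xs)
  case (Cons a xs)
  have "(\<Sum>z\<in>A. real (count_list (a # xs) z) * g z)
      = (\<Sum>z\<in>A. (if z = a then g z else 0) + real (count_list xs z) * g z)"
    by (rule sum.cong) (auto simp: algebra_simps)
  also have "\<dots> = g a + (\<Sum>z\<in>A. real (count_list xs z) * g z)"
    using assms(1) Cons.prems by (simp add: sum.distrib)
  finally show ?case using Cons by simp
qed simp

text \<open>Listing the zeros by an index, repeated according to multiplicity, turns every sum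
  weighted by \<open>order\<close> into a plain sum over \<open>i < degree q\<close>. One
  enumeration \<open>w\<close> has to serve all test functions \<open>g\<close>.\<close>

lemma complex_poly_roots_enum:
  fixes q :: "complex poly"
  assumes "q \<noteq> 0"
  shows "\<exists>w. q = smult (lead_coeff q) (\<Prod>i<degree q. [:- w i, 1:]) \<and>
           (\<forall>g :: complex \<Rightarrow> real.
             (\<Sum>z | poly q z = 0. real (order z q) * g z) = (\<Sum>i<degree q. g (w i)))"
proof -
  obtain xs where xs: "mset xs = proots q"
    using ex_mset by blast
  have len: "length xs = degree q"
    by (metis size_mset size_proots_complex xs)
  have "(\<Prod>x\<in>#proots q. [:- x, 1:]) = (\<Prod>x\<leftarrow>xs. [:- x, 1:])"
    by (subst prod_mset_prod_list [symmetric]) (simp add: xs)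
  also have "\<dots> = (\<Prod>i<degree q. [:- (xs ! i), 1:])"
    by (subst prod.list_conv_set_nth) (simp add: len atLeast0LessThan)
  finally have 1: "q = smult (lead_coeff q) (\<Prod>i<degree q. [:- (xs ! i), 1:])"
    using complex_poly_decompose_multiset[of q] by simp
  have 2: "(\<Sum>z | poly q z = 0. real (order z q) * g z) = (\<Sum>i<degree q. g (xs ! i))"
    for g :: "complex \<Rightarrow> real"
  proof -
    have "(\<Sum>i<degree q. g (xs ! i)) = (\<Sum>x\<leftarrow>xs. g x)"
      by (subst sum.list_conv_set_nth) (simp add: len atLeast0LessThan)
    also have "\<dots> = (\<Sum>z\<in>set xs. real (count_list xs z) * g z)"
      by (rule sum_list_map_eq_sum_count_real) auto
    also have "\<dots> = (\<Sum>z | poly q z = 0. real (order z q) * g z)"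
      using assms by (simp add: count_mset [symmetric] xs flip: set_mset_mset)
    finally show ?thesis ..
  qed
  from 1 2 show ?thesis by (intro exI[of _ "(!) xs"] conjI allI)
qed

text \<open>The map \<open>v / (2 * B - v)\<close> sends the half-plane \<open>Re v < B\<close> into
  the unit disc and fixes 0. The Schwarz lemma applied to its composition with \<open>h\<close>
  bounds \<open>h\<close> by \<open>2 * B\<close> on the circle of radius 1/2, and Cauchy's
  inequality on that circle bounds the coefficients.\<close>

lemma Borel_Caratheodory_coeff:
  assumes holh: "h holomorphic_on ball 0 1" and h0: "h 0 = 0"
    and Re_less: "\<And>z. cmod z < 1 \<Longrightarrow> Re (h z) < B"
  shows "cmod (fps_nth (fps_expansion h 0) m) \<le> 2 ^ m * (2 * B)"
proof -
  have Bpos: "B > 0" using Re_less[of 0] h0 by simp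
  \<comment> \<open>Points to the left of the line \<open>Re v = B\<close> are closer to 0 than to
    its mirror image \<open>2 * B\<close>.\<close>
  have less: "cmod (h z) < cmod (2 * of_real B - h z)" if "cmod z < 1" for z
  proof -
    have "(2 * B - Re (h z))\<^sup>2 - (Re (h z))\<^sup>2 = 4 * B * (B - Re (h z))"
      by (simp add: power2_eq_square algebra_simps)
    also have "\<dots> > 0" using Bpos Re_less[OF that] by simp
    finally show ?thesis
      by (simp add: cmod_def)
  qed
  define \<phi> where "\<phi> z = h z / (2 * of_real B - h z)" for z
  have nz: "2 * of_real B - h z \<noteq> 0" if "cmod z < 1" for z
    using less[OF that] by (metis norm_not_less_zero norm_zero)
  have \<phi>: "cmod (\<phi> z) \<le> cmod z" if "cmod z < 1" for z
  proof (rule Schwarz_Lemma(1)[OF _ _ _ that])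
    show "\<phi> holomorphic_on ball 0 1"
      unfolding \<phi>_def using nz by (intro holomorphic_intros holh) auto
    show "\<phi> 0 = 0" by (simp add: \<phi>_def h0)
    fix z :: complex assume "cmod z < 1"
    then show "cmod (\<phi> z) < 1"
      using less[of z] nz[of z] by (simp add: \<phi>_def norm_divide divide_less_eq)
  qed
  \<comment> \<open>On this circle the Schwarz bound reads
    \<open>cmod (h z) \<le> (2 * B + cmod (h z)) / 2\<close>, which is solved for
    \<open>cmod (h z)\<close>.\<close>
  have half: "cmod (h z) \<le> 2 * B" if "cmod (0 - z) = 1/2" for z
  proof -
    have z: "cmod z = 1/2" using that by simp
    have "cmod (h z) / cmod (2 * of_real B - h z) \<le> 1/2"
      using \<phi>[of z] z by (simp add: \<phi>_def norm_divide)
    then have "cmod (h z) \<le> 1/2 * cmod (2 * of_real B - h z)"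
      using nz[of z] z by (simp add: pos_divide_le_eq)
    also have "\<dots> \<le> 1/2 * (2 * B + cmod (h z))"
      using z Bpos norm_triangle_ineq4[of "2 * of_real B" "h z"] by (simp add: norm_mult)
    finally show ?thesis by simp
  qed
  have sub: "cball 0 (1/2) \<subseteq> ball (0::complex) 1" by auto
  have "cmod ((deriv ^^ m) h 0) \<le> fact m * (2 * B) / (1/2) ^ m"
  proof (rule Cauchy_inequality)
    show "h holomorphic_on ball 0 (1/2)"
      by (rule holomorphic_on_subset[OF holh]) auto
    show "continuous_on (cball 0 (1/2)) h"
      by (rule holomorphic_on_imp_continuous_on[OF holomorphic_on_subset[OF holh sub]])
  qed (use half in auto)
  then show ?thesis
    by (simp add: fps_expansion_def norm_divide divide_simps mult_ac)
qed

text \<open>The sum of the logarithms of the factors has the Taylor coefficients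
  \<open>- (\<Sum>i\<in>I. x i ^ m) / m\<close>, and by the maximum principle its real part is at
  most \<open>A\<close> in the disc. The gap between \<open>A\<close> and \<open>B\<close> supplies
  the strict inequality required by the Borel-Caratheodory estimate.\<close>

lemma power_sum_bound:
  fixes x :: "'i \<Rightarrow> complex"
  assumes fin: "finite I" and x: "\<And>i. i \<in> I \<Longrightarrow> cmod (x i) \<le> 1"
    and bound: "\<And>z. cmod z = 1 \<Longrightarrow> cmod (\<Prod>i\<in>I. 1 - x i * z) \<le> exp A"
    and "A < B" and m: "m > 0"
  shows "cmod (\<Sum>i\<in>I. x i ^ m) \<le> real m * 2 ^ m * (2 * B)"
proof -
  define h where "h z = (\<Sum>i\<in>I. Ln (1 - x i * z))" for z
  have small: "cmod (x i * z) < 1" if "i \<in> I" "cmod z < 1" for i z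
    using x[OF that(1)] that(2) 
    by (metis mult_left_le_one_le norm_ge_zero norm_mult order.strict_trans1)
  \<comment> \<open>Each factor stays in the right half-plane, so the principal logarithm is
    holomorphic along the whole disc.\<close>
  have Re_pos: "Re (1 - x i * z) > 0" if "i \<in> I" "cmod z < 1" for i z
    using small[OF that] complex_Re_le_cmod[of "x i * z"] by simp
  have nonneg: "1 - x i * z \<notin> \<real>\<^sub>\<le>\<^sub>0" if "i \<in> I" "cmod z < 1" for i z
    using Re_pos[OF that] by (metis complex_nonpos_Reals_iff not_less)
  have holh: "h holomorphic_on ball 0 1"
    unfolding h_def using nonneg by (intro holomorphic_intros) auto
  have exph: "exp (h z) = (\<Prod>i\<in>I. 1 - x i * z)" if "cmod z < 1" for z
  proof -
    have "1 - x i * z \<noteq> 0" if "i \<in> I" for i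
      using nonneg[OF that \<open>cmod z < 1\<close>] by auto
    then show ?thesis
      unfolding h_def by (simp add: exp_sum fin)
  qed
  have bound': "cmod (\<Prod>i\<in>I. 1 - x i * z) \<le> exp A" if "cmod z \<le> 1" for z
    by (rule maximum_modulus_frontier[of _ "cball 0 1"])
       (use that bound in \<open>auto intro!: holomorphic_intros continuous_intros simp: dist_norm\<close>)
  have "cmod (fps_nth (fps_expansion h 0) m) \<le> 2 ^ m * (2 * B)"
  proof (rule Borel_Caratheodory_coeff[OF holh])
    show "h 0 = 0" by (simp add: h_def)
    fix z :: complex assume z: "cmod z < 1"
    have "exp (Re (h z)) \<le> exp A"
      using bound'[of z] z exph[OF z] by (metis less_imp_le norm_exp_eq_Re)
    then show "Re (h z) < B" using \<open>A < B\<close> by simp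
  qed
  moreover have "fps_expansion h 0 = (\<Sum>i\<in>I. Abs_fps (\<lambda>n. - (x i ^ n) / of_nat n))"
  proof (rule fps_expansion_eqI, unfold h_def, rule has_fps_expansion_sum, rule has_fps_expansionI)
    fix i assume i: "i \<in> I"
    have "eventually (\<lambda>z. z \<in> ball (0::complex) 1) (nhds 0)"
      by (rule eventually_nhds_in_open) auto
    then show "\<forall>\<^sub>F z in nhds 0. (\<lambda>n. fps_nth (Abs_fps (\<lambda>n. - (x i ^ n) / of_nat n)) n * z ^ n)
                 sums Ln (1 - x i * z)"
    proof eventually_elim
      case (elim z)
      then show ?case
        using Ln_series'[of "- (x i * z)"] small[OF i, of z] by (simp add: power_mult_distrib)
    qed
  qed
  ultimately have "cmod (\<Sum>i\<in>I. - (x i ^ m) / of_nat m) \<le> 2 ^ m * (2 * B)"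
    by (simp add: fps_sum_nth)
  moreover have "(\<Sum>i\<in>I. - (x i ^ m) / of_nat m) = - (\<Sum>i\<in>I. x i ^ m) / of_nat m"
    by (simp add: sum_divide_distrib sum_negf)
  ultimately show ?thesis
    using m by (simp only: norm_divide norm_minus_cancel norm_of_nat) (simp add: divide_le_eq mult_ac)
qed

text \<open>A quantitative form of Jensen's inequality. With \<open>a\<close> the leading
  coefficient, \<open>B\<close> exceeds twice the logarithm of the maximum on the circle minus the
  logarithms of the leading and the constant coefficient. This one quantity controls both the radial
  spread of the zeros and the moments of their directions.\<close>

lemma zeros_near_circle:
  fixes w :: "'i \<Rightarrow> complex" and a :: complex
  assumes fin: "finite I" and a: "a \<noteq> 0" and w: "\<And>i. i \<in> I \<Longrightarrow> w i \<noteq> 0"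
    and S_pos: "S > 0" and S: "\<And>z. cmod z = 1 \<Longrightarrow> cmod (a * (\<Prod>i\<in>I. z - w i)) \<le> S"
    and B: "2 * ln S - ln (cmod a) - ln (cmod (a * (\<Prod>i\<in>I. w i))) < B"
  shows "(\<Sum>i\<in>I. \<bar>ln (cmod (w i))\<bar>) \<le> B"
    and "m > 0 \<Longrightarrow> cmod (\<Sum>i\<in>I. cnj (sgn (w i)) ^ m) \<le> real m * (2 * 2 ^ m + 1) * B"
proof -
  text \<open>Reflecting the zeros inside the disc does not change the modulus on the circle up to a
    constant factor.\<close>
  define x where "x i = (if cmod (w i) \<ge> 1 then inverse (w i) else cnj (w i))" for i
  define c where "c i = max 1 (cmod (w i))" for i
  have x_le: "cmod (x i) \<le> 1" if "i \<in> I" for i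
    by (auto simp: x_def norm_inverse intro: inverse_le_1_iff[THEN iffD2])
  have c: "c i > 0" for i by (simp add: c_def)
  have fac: "cmod (1 - x i * z) = cmod (z - w i) / c i" if "i \<in> I" "cmod z = 1" for i z
  proof (cases "cmod (w i) \<ge> 1")
    case True
    have "1 - x i * z = (w i - z) / w i" using True w[OF that(1)] by (simp add: x_def field_simps)
    then show ?thesis using True by (simp add: norm_divide c_def norm_minus_commute max_def)
  next
    case False
    have "z * cnj z = 1" using that(2) by (simp add: complex_norm_square[symmetric])
    then have "1 - x i * z = z * cnj (z - w i)" using False by (simp add: x_def algebra_simps)
    then have "cmod (1 - x i * z) = cmod z * cmod (cnj (z - w i))" by (simp only: norm_mult)
    then show ?thesis using False that(2) by (simp add: c_def del: complex_cnj_diff)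
  qed
  define C where "C = (\<Sum>i\<in>I. ln (c i))"
  define A where "A = ln S - ln (cmod a) - C"
  have bound: "cmod (\<Prod>i\<in>I. 1 - x i * z) \<le> exp A" if "cmod z = 1" for z
  proof -
    have "cmod (\<Prod>i\<in>I. 1 - x i * z) = (\<Prod>i\<in>I. cmod (z - w i)) / (\<Prod>i\<in>I. c i)"
      using fac that by (simp add: prod_norm[symmetric] prod_dividef)
    also have "(\<Prod>i\<in>I. c i) = exp C" using c by (simp add: C_def exp_sum fin)
    also have "(\<Prod>i\<in>I. cmod (z - w i)) \<le> S / cmod a"
      using S[OF that] a by (simp add: norm_mult prod_norm field_simps)
    finally show ?thesis using a S_pos
      by (simp add: A_def exp_diff divide_right_mono)
  qed
  \<comment> \<open>The reflected product equals 1 at the origin, so the maximum principle forces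
    \<open>exp A \<ge> 1\<close>. Equivalently, \<open>C \<le> ln S - ln (cmod a)\<close>.\<close>
  have "cmod (\<Prod>i\<in>I. 1 - x i * 0) \<le> exp A"
    by (rule maximum_modulus_frontier[of "\<lambda>z. \<Prod>i\<in>I. 1 - x i * z" "cball 0 1"])
       (use bound in \<open>auto intro!: holomorphic_intros continuous_intros simp: dist_norm\<close>)
  then have A0: "A \<ge> 0" by simp
  have lnw: "ln (cmod (a * (\<Prod>i\<in>I. w i))) = ln (cmod a) + (\<Sum>i\<in>I. ln (cmod (w i)))"
    using a w fin by (simp add: norm_mult ln_mult prod_norm[symmetric] ln_prod)
  \<comment> \<open>This is \<open>\<bar>t\<bar> = 2 * max 0 t - t\<close> for
    \<open>t = ln (cmod (w i))\<close>.\<close>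
  have abs_ln: "\<bar>ln (cmod (w i))\<bar> = 2 * ln (c i) - ln (cmod (w i))" if "i \<in> I" for i
    using w[OF that] by (auto simp: c_def max_def)
  have "(\<Sum>i\<in>I. \<bar>ln (cmod (w i))\<bar>) = 2 * C - (\<Sum>i\<in>I. ln (cmod (w i)))"
    using abs_ln by (simp add: C_def sum_subtractf sum_distrib_left)
  also have "\<dots> \<le> B" using A0 B lnw by (simp add: A_def)
  finally show sum_abs: "(\<Sum>i\<in>I. \<bar>ln (cmod (w i))\<bar>) \<le> B" .
  \<comment> \<open>The quantity below \<open>B\<close> equals
    \<open>2 * A + C + (C - (\<Sum>i\<in>I. ln (cmod (w i))))\<close>, a sum of nonnegative terms
    that is at least \<open>A\<close>.\<close>
  have "(\<Sum>i\<in>I. ln (cmod (w i))) \<le> C"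
    unfolding C_def by (rule sum_mono) (use w in \<open>auto simp: c_def\<close>)
  moreover have "C \<ge> 0" unfolding C_def by (rule sum_nonneg) (auto simp: c_def)
  ultimately have AB: "A < B" using B lnw A0 by (simp add: A_def)
  assume m: "m > 0"
  \<comment> \<open>After reflection, \<open>x i\<close> has the argument of
    \<open>cnj (sgn (w i))\<close> and modulus \<open>exp (- \<bar>ln (cmod (w i))\<bar>)\<close>;
    the rest is \<open>1 - exp (- t) \<le> t\<close>.\<close>
  have diff: "cmod (cnj (sgn (w i)) ^ m - x i ^ m) \<le> real m * \<bar>ln (cmod (w i))\<bar>" if "i \<in> I" for i
  proof -
    have x_eq: "x i = cnj (sgn (w i)) * of_real (exp (- \<bar>ln (cmod (w i))\<bar>))"
    proof (cases "cmod (w i) \<ge> 1")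
      case True
      then have "w i * cnj (w i) = of_real (cmod (w i)) * of_real (cmod (w i))"
        by (simp add: complex_norm_square[symmetric] power2_eq_square)
      with True w[OF that] show ?thesis
        by (simp add: x_def exp_minus sgn_eq field_simps)
    next
      case False
      then show ?thesis using w[OF that] by (simp add: x_def sgn_eq)
    qed
    have u: "cmod (sgn (w i)) = 1" using w[OF that] by (simp add: norm_sgn)
    have "cnj (sgn (w i)) ^ m - x i ^ m
        = cnj (sgn (w i)) ^ m * of_real (1 - exp (- (real m * \<bar>ln (cmod (w i))\<bar>)))"
      by (simp add: x_eq power_mult_distrib exp_of_nat_mult[symmetric] algebra_simps
           flip: of_real_power)
    also have "cmod \<dots> = \<bar>1 - exp (- (real m * \<bar>ln (cmod (w i))\<bar>))\<bar>"
      using u by (simp add: norm_mult norm_power del: of_real_diff)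
    also have "\<dots> = 1 - exp (- (real m * \<bar>ln (cmod (w i))\<bar>))" by simp
    also have "\<dots> \<le> real m * \<bar>ln (cmod (w i))\<bar>"
      using exp_ge_add_one_self[of "- (real m * \<bar>ln (cmod (w i))\<bar>)"] by simp
    finally show ?thesis .
  qed
  have "cmod (\<Sum>i\<in>I. cnj (sgn (w i)) ^ m)
      = cmod ((\<Sum>i\<in>I. cnj (sgn (w i)) ^ m - x i ^ m) + (\<Sum>i\<in>I. x i ^ m))"
    by (simp add: sum_subtractf)
  also have "\<dots> \<le> cmod (\<Sum>i\<in>I. cnj (sgn (w i)) ^ m - x i ^ m) + cmod (\<Sum>i\<in>I. x i ^ m)"
    by (rule norm_triangle_ineq)
  also have "\<dots> \<le> (\<Sum>i\<in>I. real m * \<bar>ln (cmod (w i))\<bar>) + real m * 2 ^ m * (2 * B)"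
    by (intro add_mono sum_norm_le diff power_sum_bound[OF fin x_le bound AB m])
  also have "\<dots> \<le> real m * B + real m * 2 ^ m * (2 * B)"
    using sum_abs by (simp add: sum_distrib_left[symmetric] mult_left_mono)
  finally show "cmod (\<Sum>i\<in>I. cnj (sgn (w i)) ^ m) \<le> real m * (2 * 2 ^ m + 1) * B"
    by (simp add: algebra_simps)
qed

section \<open>Equidistribution on the circle\<close>

lemma prob_space_circle_measure: "prob_space circle_measure"
  unfolding circle_measure_def
  by (intro prob_space.prob_space_distr prob_space_uniform_measure)
     (auto simp: uniform_measure_def intro!: borel_measurable_continuous_onI continuous_intros)

lemma AE_circle_measure: "AE u in circle_measure. cmod u = 1"
  unfolding circle_measure_def
  by (subst AE_distr_iff)
     (auto simp: uniform_measure_def intro!: borel_measurable_continuous_onI continuous_intros)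

lemma sets_circle_measure [simp]: "sets circle_measure = sets borel"
  by (simp add: circle_measure_def)

text \<open>The measure is concentrated on a compact set, where continuity already gives a
  bound.\<close>

lemma integrable_circle_measure:
  fixes g :: "complex \<Rightarrow> 'b::{banach, second_countable_topology}"
  assumes "continuous_on UNIV g"
  shows "integrable circle_measure g"
proof -
  interpret prob_space circle_measure by (rule prob_space_circle_measure)
  have "compact (g ` sphere 0 1)"
    using assms by (intro compact_continuous_image continuous_on_subset[OF assms]) auto
  then obtain b where b: "\<And>u. cmod u = 1 \<Longrightarrow> norm (g u) \<le> b"
    by (metis bounded_iff compact_imp_bounded image_eqI mem_sphere_0)
  show ?thesis
  proof (rule integrable_const_bound)
    show "AE u in circle_measure. norm (g u) \<le> b"
      using AE_circle_measure by eventually_elim (rule b)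
    show "g \<in> borel_measurable circle_measure"
      using borel_measurable_continuous_onI[OF assms] by (simp cong: measurable_cong_sets)
  qed
qed

text \<open>The density is brought into the form \<open>ennreal\<close> of a real function, the
  shape in which Bochner integrals over a density are evaluated.\<close>

lemma circle_measure_eq:
  "circle_measure = distr (density lborel (\<lambda>t. ennreal (indicator {0..2 * pi} t / (2 * pi)))) borel cis"
  unfolding circle_measure_def uniform_measure_def
  by (rule arg_cong[where f = "\<lambda>M. distr M borel cis"], rule density_cong)
     (auto simp: divide_ennreal[symmetric] indicator_def)

text \<open>Orthonormality of the characters of the circle, with powers of \<open>cnj u\<close>
  standing for negative powers. Off the diagonal, the antiderivative
  \<open>cis (l * t) / (\<i> * l)\<close> takes equal values at both ends of the period because
  \<open>l\<close> is an integer.\<close>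

lemma integral_circle_measure_cis:
  "(\<integral>u. u ^ j * cnj u ^ K \<partial>circle_measure) = (if j = K then 1 else 0)"
proof -
  interpret prob_space circle_measure by (rule prob_space_circle_measure)
  show ?thesis
  proof (cases "j = K")
    case True
    have "(\<integral>u. u ^ j * cnj u ^ K \<partial>circle_measure) = (\<integral>u. 1 \<partial>circle_measure)"
    proof (rule integral_cong_AE)
      show "AE u in circle_measure. u ^ j * cnj u ^ K = 1"
        using AE_circle_measure
        by eventually_elim (simp add: True power_mult_distrib[symmetric] complex_norm_square[symmetric])
    qed (auto intro!: borel_measurable_continuous_onI continuous_intros cong: measurable_cong_sets)
    then show ?thesis using True prob_space by simp
  next
    case False
    define l where "l = real j - real K"
    have l: "l \<noteq> 0" using False by (simp add: l_def)
    have cis: "cis t ^ j * cnj (cis t) ^ K = cis (l * t)" for t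
      by (simp add: cis_cnj Complex.DeMoivre cis_mult l_def algebra_simps)
    have "(\<integral>u. u ^ j * cnj u ^ K \<partial>circle_measure)
        = (\<integral>t. cis t ^ j * cnj (cis t) ^ K
             \<partial>density lborel (\<lambda>t. ennreal (indicator {0..2 * pi} t / (2 * pi))))"
      unfolding circle_measure_eq
      by (rule integral_distr)
         (auto intro!: borel_measurable_continuous_onI continuous_intros)
    also have "\<dots> = (\<integral>t. (indicator {0..2 * pi} t / (2 * pi)) *\<^sub>R cis (l * t) \<partial>lborel)"
      unfolding cis
      by (rule integral_density)
         (auto intro!: borel_measurable_continuous_onI continuous_intros)
    also have "\<dots> = (\<integral>t. indicator {0..2 * pi} t *\<^sub>R cis (l * t) \<partial>lborel) /\<^sub>R (2 * pi)"
    proof -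
      have "(indicator {0..2 * pi} t / (2 * pi)) *\<^sub>R cis (l * t)
          = inverse (2 * pi) *\<^sub>R (indicator {0..2 * pi} t *\<^sub>R cis (l * t))" for t
        unfolding scaleR_scaleR by (simp only: divide_inverse mult.commute)
      then show ?thesis by (simp only: integral_scaleR_right)
    qed
    also have "(\<integral>t. indicator {0..2 * pi} t *\<^sub>R cis (l * t) \<partial>lborel)
        = cis (l * (2 * pi)) / (\<i> * l) - cis (l * 0) / (\<i> * l)"
    proof (rule integral_FTC_Icc[where F = "\<lambda>t. cis (l * t) / (\<i> * l)"])
      show "continuous_on {0..2 * pi} (\<lambda>t. cis (l * t))"
        by (intro continuous_intros)
      fix t
      show "((\<lambda>t. cis (l * t) / (\<i> * l)) has_vector_derivative cis (l * t)) (at t within {0..2 * pi})"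
        unfolding cis_conv_exp of_real_mult
        by (rule has_vector_derivative_real_field)
           (use l in \<open>auto intro!: derivative_eq_intros simp: field_simps\<close>)
    qed simp
    also have "cis (l * (2 * pi)) = 1"
      using cis_multiple_2pi[of l] by (simp add: l_def mult_ac)
    finally show ?thesis using False by simp
  qed
qed

lemma integral_circle_measure_poly:
  "(\<integral>u. poly T u * cnj u ^ K \<partial>circle_measure) = coeff T K"
proof -
  have "(\<integral>u. poly T u * cnj u ^ K \<partial>circle_measure)
      = (\<integral>u. (\<Sum>j\<le>degree T. coeff T j * (u ^ j * cnj u ^ K)) \<partial>circle_measure)"
    by (simp only: poly_altdef sum_distrib_right mult.assoc)
  also have "\<dots> = (\<Sum>j\<le>degree T. coeff T j * (\<integral>u. u ^ j * cnj u ^ K \<partial>circle_measure))"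
    by (subst Bochner_Integration.integral_sum)
       (auto intro!: integrable_circle_measure continuous_intros)
  also have "\<dots> = coeff T K"
    by (simp add: integral_circle_measure_cis if_distrib[where f = "(*) _"] coeff_eq_0 cong: if_cong)
  finally show ?thesis .
qed

text \<open>Polynomials in the real and imaginary part restrict to trigonometric polynomials. Since
  \<open>cnj u\<close> is the inverse of \<open>u\<close> on the circle, these are written as a
  polynomial over a common power of \<open>u\<close>.\<close>

lemma real_polynomial_function_on_circle:
  fixes P :: "complex \<Rightarrow> real"
  assumes "real_polynomial_function P"
  shows "\<exists>T K. \<forall>u. cmod u = 1 \<longrightarrow> of_real (P u) = poly T u * cnj u ^ K"
  using assms
proof induction
  case (linear f)
  interpret bounded_linear f by fact
  \<comment> \<open>With this \<open>c\<close>, the linear functional is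
    \<open>f u = Re (c * u)\<close>.\<close>
  define c where "c = Complex (f 1) (- f \<i>)"
  have "of_real (f u) = poly [:cnj c / 2, 0, c / 2:] u * cnj u ^ 1" if "cmod u = 1" for u
  proof -
    have "f u = Re u * f 1 + Im u * f \<i>"
      using add[of "Re u *\<^sub>R 1" "Im u *\<^sub>R \<i>"] scaleR[of "Re u" 1] scaleR[of "Im u" \<i>]
      by (simp add: scaleR_conv_of_real complex_eq[symmetric] mult.commute)
    then have "of_real (f u) = cnj c / 2 * cnj u + c / 2 * u"
      by (simp add: complex_eq_iff c_def field_simps)
    also have "\<dots> = cnj c / 2 * cnj u + c / 2 * u * (u * cnj u)"
      using that by (simp add: complex_norm_square[symmetric])
    finally show ?thesis by (simp add: algebra_simps)
  qed
  then show ?case by blast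
next
  case (const c)
  have "of_real c = poly [:of_real c:] u * cnj u ^ 0" for u by simp
  then show ?case by blast
next
  case (add f g)
  then obtain T1 K1 T2 K2 where T: "\<forall>u. cmod u = 1 \<longrightarrow> of_real (f u) = poly T1 u * cnj u ^ K1"
    "\<forall>u. cmod u = 1 \<longrightarrow> of_real (g u) = poly T2 u * cnj u ^ K2" by blast
  \<comment> \<open>Both summands are brought to the exponent \<open>K1 + K2\<close> by inserting
    factors \<open>u ^ n * cnj u ^ n = 1\<close>.\<close>
  have "of_real (f u + g u) = poly (T1 * monom 1 K2 + T2 * monom 1 K1) u * cnj u ^ (K1 + K2)"
    if "cmod u = 1" for u
  proof -
    have "u * cnj u = 1" using that by (simp add: complex_norm_square[symmetric])
    then have "u ^ n * cnj u ^ n = 1" for n by (simp add: power_mult_distrib[symmetric])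
    then have "poly T1 u * cnj u ^ K1 = poly T1 u * cnj u ^ K1 * (u ^ K2 * cnj u ^ K2)"
      "poly T2 u * cnj u ^ K2 = poly T2 u * cnj u ^ K2 * (u ^ K1 * cnj u ^ K1)"
      by simp_all
    then have "of_real (f u + g u) = poly T1 u * cnj u ^ K1 * (u ^ K2 * cnj u ^ K2)
        + poly T2 u * cnj u ^ K2 * (u ^ K1 * cnj u ^ K1)"
      using T that by (simp only: of_real_add)
    also have "\<dots> = poly (T1 * monom 1 K2 + T2 * monom 1 K1) u * cnj u ^ (K1 + K2)"
      by (simp add: poly_monom power_add algebra_simps)
    finally show ?thesis .
  qed
  then show ?case by blast
next
  case (mult f g)
  then obtain T1 K1 T2 K2 where T: "\<forall>u. cmod u = 1 \<longrightarrow> of_real (f u) = poly T1 u * cnj u ^ K1"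
    "\<forall>u. cmod u = 1 \<longrightarrow> of_real (g u) = poly T2 u * cnj u ^ K2" by blast
  have "of_real (f u * g u) = poly (T1 * T2) u * cnj u ^ (K1 + K2)" if "cmod u = 1" for u
    using T that by (simp add: power_add)
  then show ?case by blast
qed

text \<open>Averages of \<open>u ^ j * cnj u ^ K\<close> are moments of order \<open>K - j\<close>
  when \<open>j < K\<close>, conjugates of moments when \<open>j > K\<close>, and eventually 1 when
  \<open>j = K\<close>. The limit is thus the value of the corresponding integral over the
  circle.\<close>

lemma average_poly_tendsto:
  fixes u :: "nat \<Rightarrow> nat \<Rightarrow> complex"
  assumes N: "filterlim N at_top sequentially"
    and u: "\<And>k i. i < N k \<Longrightarrow> cmod (u k i) = 1"
    and mom: "\<And>m. m > 0 \<Longrightarrow> (\<lambda>k. (\<Sum>i<N k. cnj (u k i) ^ m) / of_nat (N k)) \<longlonglongrightarrow> 0"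
  shows "(\<lambda>k. (\<Sum>i<N k. poly T (u k i) * cnj (u k i) ^ K) / of_nat (N k)) \<longlonglongrightarrow> coeff T K"
proof -
  have one: "u k i ^ n * cnj (u k i) ^ n = 1" if "i < N k" for k i n
    using u[OF that] by (simp add: power_mult_distrib[symmetric] complex_norm_square[symmetric])
  have mono: "(\<lambda>k. (\<Sum>i<N k. u k i ^ j * cnj (u k i) ^ K) / of_nat (N k))
      \<longlonglongrightarrow> (if j = K then 1 else 0)" for j
  proof (cases j K rule: linorder_cases)
    case less
    have "(\<Sum>i<N k. u k i ^ j * cnj (u k i) ^ K) = (\<Sum>i<N k. cnj (u k i) ^ (K - j))" for k
    proof (rule sum.cong)
      fix i assume i: "i \<in> {..<N k}"
      have "cnj (u k i) ^ K = cnj (u k i) ^ j * cnj (u k i) ^ (K - j)"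
        using less by (simp flip: power_add)
      then show "u k i ^ j * cnj (u k i) ^ K = cnj (u k i) ^ (K - j)"
        using one[of i k j] i by (simp add: mult.assoc[symmetric])
    qed simp
    then show ?thesis using mom[of "K - j"] less by simp
  next
    case equal
    have "eventually (\<lambda>k. N k > 0) sequentially"
      using N by (rule eventually_gt_at_top[THEN filterlim_iff[THEN iffD1, rule_format, rotated]])
    then have "eventually (\<lambda>k. (\<Sum>i<N k. u k i ^ j * cnj (u k i) ^ K) / of_nat (N k) = 1) sequentially"
      by eventually_elim (simp add: equal one)
    then show ?thesis using equal by (simp add: tendsto_eventually)
  next
    case greater
    have "(\<Sum>i<N k. u k i ^ j * cnj (u k i) ^ K) = cnj (\<Sum>i<N k. cnj (u k i) ^ (j - K))" for k
      unfolding cnj_sum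
    proof (rule sum.cong)
      fix i assume i: "i \<in> {..<N k}"
      have "u k i ^ j = u k i ^ (j - K) * u k i ^ K"
        using greater by (simp flip: power_add)
      then show "u k i ^ j * cnj (u k i) ^ K = cnj (cnj (u k i) ^ (j - K))"
        using one[of i k K] i by (simp add: mult.assoc)
    qed simp
    then show ?thesis using tendsto_cnj[OF mom[of "j - K"]] greater by simp
  qed
  have "(\<lambda>k. \<Sum>j\<le>degree T. coeff T j * ((\<Sum>i<N k. u k i ^ j * cnj (u k i) ^ K) / of_nat (N k)))
      \<longlonglongrightarrow> (\<Sum>j\<le>degree T. coeff T j * (if j = K then 1 else 0))"
    by (intro tendsto_intros mono)
  moreover have "(\<Sum>j\<le>degree T. coeff T j * (if j = K then 1 else 0)) = coeff T K"
    by (simp add: if_distrib[where f = "(*) _"] coeff_eq_0 cong: if_cong)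
  moreover have "(\<Sum>j\<le>degree T. coeff T j * ((\<Sum>i<N k. u k i ^ j * cnj (u k i) ^ K) / of_nat (N k)))
      = (\<Sum>i<N k. poly T (u k i) * cnj (u k i) ^ K) / of_nat (N k)" for k
    unfolding poly_altdef sum_distrib_right sum_distrib_left times_divide_eq_right
      sum_divide_distrib[symmetric]
    by (subst sum.swap) (simp add: mult_ac)
  ultimately show ?thesis by simp
qed

text \<open>By Stone-Weierstrass, \<open>g\<close> is uniformly close on the circle to a
  trigonometric polynomial \<open>P\<close>, for which the vanishing moments give the limit.\<close>

lemma Weyl_criterion_circle:
  fixes u :: "nat \<Rightarrow> nat \<Rightarrow> complex" and g :: "complex \<Rightarrow> real"
  assumes N: "filterlim N at_top sequentially"
    and u: "\<And>k i. i < N k \<Longrightarrow> cmod (u k i) = 1"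
    and mom: "\<And>m. m > 0 \<Longrightarrow> (\<lambda>k. (\<Sum>i<N k. cnj (u k i) ^ m) / of_nat (N k)) \<longlonglongrightarrow> 0"
    and g: "continuous_on UNIV g"
  shows "(\<lambda>k. (\<Sum>i<N k. g (u k i)) / real (N k)) \<longlonglongrightarrow> integral\<^sup>L circle_measure g"
proof (rule LIMSEQ_I)
  interpret prob_space circle_measure by (rule prob_space_circle_measure)
  fix r :: real assume "r > 0"
  \<comment> \<open>Three errors of size \<open>e\<close> arise: replacing \<open>g\<close> by
    \<open>P\<close> in the average, replacing it in the integral, and the convergence for
    \<open>P\<close> itself.\<close>
  define e where "e = r / 4"
  have e: "e > 0" using \<open>r > 0\<close> by (simp add: e_def)
  obtain P where P: "real_polynomial_function P" "\<And>x. x \<in> sphere 0 1 \<Longrightarrow> \<bar>g x - P x\<bar> < e"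
    using Stone_Weierstrass_real_polynomial_function[of "sphere 0 1" g e] e
      continuous_on_subset[OF g] by auto
  obtain T K where T: "\<And>u. cmod u = 1 \<Longrightarrow> of_real (P u) = poly T u * cnj u ^ K"
    using real_polynomial_function_on_circle[OF P(1)] by blast
  have contP: "continuous_on UNIV P"
    using P(1) by (simp add: continuous_on_polymonial_function real_polynomial_function_eq)
  have "complex_of_real (integral\<^sup>L circle_measure P) = (\<integral>u. of_real (P u) \<partial>circle_measure)"
    by simp
  also have "\<dots> = (\<integral>u. poly T u * cnj u ^ K \<partial>circle_measure)"
    using AE_circle_measure contP
    by (intro integral_cong_AE)
       (auto simp: T intro!: borel_measurable_continuous_onI continuous_intros cong: measurable_cong_sets elim: eventually_mono)
  finally have intP: "complex_of_real (integral\<^sup>L circle_measure P) = coeff T K"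
    by (simp add: integral_circle_measure_poly)
  have "\<bar>integral\<^sup>L circle_measure g - integral\<^sup>L circle_measure P\<bar>
      = \<bar>\<integral>u. g u - P u \<partial>circle_measure\<bar>"
    using integrable_circle_measure[OF g] integrable_circle_measure[OF contP] by simp
  also have "\<dots> \<le> (\<integral>u. \<bar>g u - P u\<bar> \<partial>circle_measure)"
    by (rule integral_abs_bound)
  also have "\<dots> \<le> (\<integral>u. e \<partial>circle_measure)"
  proof (rule integral_mono_AE)
    show "AE u in circle_measure. \<bar>g u - P u\<bar> \<le> e"
      using AE_circle_measure by eventually_elim (use P(2) in \<open>auto simp: less_imp_le\<close>)
  qed (auto intro!: integrable_circle_measure continuous_intros g contP)
  finally have int_diff: "\<bar>integral\<^sup>L circle_measure g - integral\<^sup>L circle_measure P\<bar> \<le> e"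
    using prob_space by simp
  have "(\<Sum>i<N k. poly T (u k i) * cnj (u k i) ^ K) / of_nat (N k)
      = complex_of_real ((\<Sum>i<N k. P (u k i)) / real (N k))" for k
    using T u by simp
  then have "(\<lambda>k. (\<Sum>i<N k. P (u k i)) / real (N k)) \<longlonglongrightarrow> integral\<^sup>L circle_measure P"
    using average_poly_tendsto[OF N u mom, of T K] by (simp only: intP[symmetric] tendsto_of_real_iff)
  then have "eventually (\<lambda>k. \<bar>(\<Sum>i<N k. P (u k i)) / real (N k) - integral\<^sup>L circle_measure P\<bar> < e) sequentially"
    using e by (simp add: tendsto_iff dist_real_def)
  moreover have "eventually (\<lambda>k. N k > 0) sequentially"
    using N by (rule eventually_gt_at_top[THEN filterlim_iff[THEN iffD1, rule_format, rotated]])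
  ultimately have "eventually (\<lambda>k. norm ((\<Sum>i<N k. g (u k i)) / real (N k) - integral\<^sup>L circle_measure g) < r) sequentially"
  proof eventually_elim
    case (elim k)
    have "\<bar>(\<Sum>i<N k. g (u k i)) - (\<Sum>i<N k. P (u k i))\<bar> \<le> (\<Sum>i<N k. \<bar>g (u k i) - P (u k i)\<bar>)"
      by (simp only: sum_subtractf[symmetric] sum_abs)
    also have "\<dots> \<le> (\<Sum>i<N k. e)"
      by (intro sum_mono less_imp_le P(2)) (simp add: u)
    finally have "\<bar>(\<Sum>i<N k. g (u k i)) / real (N k) - (\<Sum>i<N k. P (u k i)) / real (N k)\<bar> \<le> e"
      using elim(2) by (simp add: diff_divide_distrib[symmetric] abs_divide divide_le_eq mult.commute)
    moreover have "\<bar>a - d\<bar> < r" if "\<bar>a - b\<bar> \<le> e" "\<bar>b - c\<bar> < e" "\<bar>d - c\<bar> \<le> e" for a b c d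
      using that e unfolding e_def by linarith
    ultimately show ?case using elim(1) int_diff unfolding real_norm_def by blast
  qed
  then show "\<exists>no. \<forall>n\<ge>no. norm ((\<Sum>i<N n. g (u n i)) / real (N n) - integral\<^sup>L circle_measure g) < r"
    by (simp add: eventually_sequentially)
qed

section \<open>Passing from directions of zeros to the zeros themselves\<close>

text \<open>Near the circle uniform continuity makes the difference small; away from it
  \<open>\<bar>ln (cmod w)\<bar>\<close> exceeds a fixed \<open>b\<close>, and a multiple of it
  dominates the bounded difference. Being linear in \<open>\<bar>ln (cmod w)\<bar>\<close>, the
  bound can be averaged over all zeros.\<close>

lemma continuous_sgn_bound:
  fixes g :: "complex \<Rightarrow> real"
  assumes g: "continuous_on UNIV g" and bd: "\<And>z. \<bar>g z\<bar> \<le> G" and e: "e > 0"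
  obtains c where "c > 0" "\<And>w. w \<noteq> 0 \<Longrightarrow> \<bar>g w - g (sgn w)\<bar> \<le> e + c * \<bar>ln (cmod w)\<bar>"
proof -
  have "uniformly_continuous_on (cball 0 2) g"
    by (intro compact_uniformly_continuous continuous_on_subset[OF g]) auto
  then obtain d where d: "d > 0"
    and dist: "\<And>x y. x \<in> cball 0 2 \<Longrightarrow> y \<in> cball 0 2 \<Longrightarrow> dist y x < d \<Longrightarrow> dist (g y) (g x) < e"
    using e unfolding uniformly_continuous_on_def by metis
  \<comment> \<open>The bound \<open>\<bar>ln (cmod w)\<bar> \<le> b\<close> then gives
    \<open>\<bar>cmod w - 1\<bar> \<le> min d 1 / 2\<close>, which is below \<open>d\<close> and
    keeps \<open>w\<close> in the disc of radius 2.\<close>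
  define b where "b = ln (1 + min d 1 / 2)"
  have b: "b > 0" using d by (simp add: b_def)
  have G: "G \<ge> 0" using bd[of 0] by simp
  have "\<bar>g w - g (sgn w)\<bar> \<le> e + (2 * G + 1) / b * \<bar>ln (cmod w)\<bar>" if w: "w \<noteq> 0" for w
  proof (cases "\<bar>ln (cmod w)\<bar> \<le> b")
    case True
    have "exp b = 1 + min d 1 / 2" using d by (simp add: b_def)
    moreover have "cmod w \<le> exp b"
      using True w by (metis abs_le_D1 exp_le_cancel_iff exp_ln zero_less_norm_iff)
    moreover have "exp (- b) \<le> cmod w"
      using True w by (metis abs_le_D2 exp_le_cancel_iff exp_ln minus_le_iff zero_less_norm_iff)
    moreover have "exp (- b) \<ge> 1 - min d 1 / 2"
    proof -
      have "b \<le> min d 1 / 2" unfolding b_def by (rule ln_add_one_self_le_self) (use d in simp)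
      then show ?thesis using exp_ge_add_one_self[of "- b"] by linarith
    qed
    ultimately have "\<bar>cmod w - 1\<bar> \<le> min d 1 / 2" by linarith
    moreover have "dist w (sgn w) = \<bar>cmod w - 1\<bar>"
    proof -
      have "w - sgn w = of_real (cmod w - 1) * sgn w"
        using w by (simp add: sgn_eq field_simps)
      then show ?thesis using w
        by (simp add: dist_norm norm_mult norm_sgn del: of_real_diff)
    qed
    moreover from this have "cmod w \<le> 2" using calculation(1) by linarith
    ultimately have "dist (g w) (g (sgn w)) < e"
      using d w by (intro dist) (auto simp: norm_sgn)
    moreover have "(2 * G + 1) / b * \<bar>ln (cmod w)\<bar> \<ge> 0" using b G by simp
    ultimately show ?thesis by (simp add: dist_real_def)
  next
    case False
    have "\<bar>g w - g (sgn w)\<bar> \<le> 2 * G + 1"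
      using bd[of w] bd[of "sgn w"] by linarith
    also have "\<dots> = (2 * G + 1) / b * b" using b by simp
    also have "\<dots> \<le> (2 * G + 1) / b * \<bar>ln (cmod w)\<bar>"
      by (rule mult_left_mono) (use False b G in auto)
    finally show ?thesis using e by simp
  qed
  moreover have "(2 * G + 1) / b > 0" using b G by simp
  ultimately show ?thesis using that by blast
qed

lemma integral_zero_measure:
  fixes g :: "complex \<Rightarrow> real"
  assumes q: "q \<noteq> 0" and g: "g \<in> borel_measurable borel"
  shows "integral\<^sup>L (zero_measure q) g
    = (\<Sum>z | poly q z = 0. real (order z q) * g z) / real (degree q)"
proof -
  have fin: "finite {z. poly q z = 0}" using q by (rule poly_roots_finite)
  have "integral\<^sup>L (zero_measure q) g = integral\<^sup>L (point_measure {z. poly q z = 0}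
      (\<lambda>z. ennreal (real (order z q) / real (degree q)))) g"
    unfolding zero_measure_def
    by (rule integral_distr) (auto simp: g point_measure_def)
  also have "\<dots> = (\<Sum>z | poly q z = 0. real (order z q) / real (degree q) * g z)"
    using fin by (subst lebesgue_integral_point_measure_finite) auto
  finally show ?thesis by (simp add: sum_divide_distrib)
qed

text \<open>The subexponential bounds make the quantity \<open>B\<close> of
  \<open>zeros_near_circle\<close> small compared with the degree. Hence the directions of the zeros
  satisfy the Weyl criterion, and the average of \<open>\<bar>ln (cmod (w k i))\<bar>\<close> tends
  to 0, which transfers the limit from directions to zeros.\<close>

theorem zero_measure_weakly_converges:
  fixes q :: "nat \<Rightarrow> complex poly"
  assumes deg: "filterlim (\<lambda>k. degree (q k)) at_top sequentially"
    and lead: "\<And>e. e > 0 \<Longrightarrow> \<forall>\<^sub>F k in sequentially. exp (- e * real (degree (q k))) \<le> cmod (lead_coeff (q k))"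
    and const: "\<And>e. e > 0 \<Longrightarrow> \<forall>\<^sub>F k in sequentially. exp (- e * real (degree (q k))) \<le> cmod (coeff (q k) 0)"
    and sup: "\<And>e. e > 0 \<Longrightarrow> \<forall>\<^sub>F k in sequentially.
                \<forall>z. cmod z = 1 \<longrightarrow> cmod (poly (q k) z) \<le> exp (e * real (degree (q k)))"
  shows "weakly_converges (\<lambda>k. zero_measure (q k)) circle_measure"
proof -
  let ?N = "\<lambda>k. degree (q k)"
  have ex: "\<forall>k. \<exists>w. q k \<noteq> 0 \<longrightarrow> q k = smult (lead_coeff (q k)) (\<Prod>i<?N k. [:- w i, 1:]) \<and>
      (\<forall>g :: complex \<Rightarrow> real.
           (\<Sum>z | poly (q k) z = 0. real (order z (q k)) * g z) = (\<Sum>i<?N k. g (w i)))"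
  proof
    fix k
    show "\<exists>w. q k \<noteq> 0 \<longrightarrow> q k = smult (lead_coeff (q k)) (\<Prod>i<?N k. [:- w i, 1:]) \<and>
      (\<forall>g :: complex \<Rightarrow> real.
           (\<Sum>z | poly (q k) z = 0. real (order z (q k)) * g z) = (\<Sum>i<?N k. g (w i)))"
    proof (cases "q k = 0")
      case False
      from complex_poly_roots_enum[OF this] show ?thesis by (elim exE) (intro exI impI)
    qed simp
  qed
  from choice[OF ex] obtain w
    where W: "\<forall>k. q k \<noteq> 0 \<longrightarrow> q k = smult (lead_coeff (q k)) (\<Prod>i<?N k. [:- w k i, 1:]) \<and>
      (\<forall>g :: complex \<Rightarrow> real.
           (\<Sum>z | poly (q k) z = 0. real (order z (q k)) * g z) = (\<Sum>i<?N k. g (w k i)))"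
    by (elim exE)
  have w: "q k = smult (lead_coeff (q k)) (\<Prod>i<?N k. [:- w k i, 1:])"
    and sum_w: "(\<Sum>z | poly (q k) z = 0. real (order z (q k)) * (g z :: real)) = (\<Sum>i<?N k. g (w k i))"
    if "q k \<noteq> 0" for k g
    by (fact W[rule_format, OF that, THEN conjunct1], fact W[rule_format, OF that, THEN conjunct2, rule_format])
  have poly_w: "poly (q k) z = lead_coeff (q k) * (\<Prod>i<?N k. z - w k i)" if "q k \<noteq> 0" for k z
    using arg_cong[OF w[OF that], of "\<lambda>p. poly p z"] by (simp add: poly_prod)
  have pos: "\<forall>\<^sub>F k in sequentially. ?N k > 0"
    using deg by (rule eventually_gt_at_top[THEN filterlim_iff[THEN iffD1, rule_format, rotated]])
  have nz: "\<forall>\<^sub>F k in sequentially. q k \<noteq> 0 \<and> (\<forall>i<?N k. w k i \<noteq> 0)"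
    using const[of 1, OF zero_less_one]
  proof eventually_elim
    case (elim k)
    then have c: "coeff (q k) 0 \<noteq> 0" by (auto simp: not_le)
    then have "q k \<noteq> 0" by auto
    moreover have "w k i \<noteq> 0" if "i < ?N k" for i
      using poly_w[OF \<open>q k \<noteq> 0\<close>, of 0] c that by (auto simp: poly_0_coeff_0)
    ultimately show ?case by blast
  qed
  \<comment> \<open>The logarithm of the maximum enters twice and each coefficient once, which gives
    \<open>4 * e * real (?N k)\<close>; the factor 5 leaves room for a strict inequality.\<close>
  define B where "B e k = 5 * e * real (?N k)" for e k
  have ev: "\<forall>\<^sub>F k in sequentially. (\<Sum>i<?N k. \<bar>ln (cmod (w k i))\<bar>) \<le> B e k \<and>
      (\<forall>m>0. cmod (\<Sum>i<?N k. cnj (sgn (w k i)) ^ m) \<le> real m * (2 * 2 ^ m + 1) * B e k)"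
    if e: "e > 0" for e
    using lead[OF e] const[OF e] sup[OF e] nz pos
  proof eventually_elim
    case (elim k)
    have wnz: "w k i \<noteq> 0" if "i \<in> {..<?N k}" for i using elim that by simp
    have a: "lead_coeff (q k) \<noteq> 0" using elim by simp
    have S: "cmod (lead_coeff (q k) * (\<Prod>i<?N k. z - w k i)) \<le> exp (e * real (?N k))"
      if "cmod z = 1" for z
      unfolding poly_w[OF conjunct1[OF elim(4)], symmetric] using elim(3) that by blast
    have "cmod (lead_coeff (q k) * (\<Prod>i<?N k. w k i)) = cmod (coeff (q k) 0)"
      using elim(4) poly_w[of k 0] by (simp add: poly_0_coeff_0 norm_mult prod_norm[symmetric])
    then have "ln (cmod (lead_coeff (q k) * (\<Prod>i<?N k. w k i))) \<ge> - e * real (?N k)"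
      using elim(2) by (subst ln_ge_iff) (auto intro: less_le_trans[OF exp_gt_zero])
    moreover have "ln (cmod (lead_coeff (q k))) \<ge> - e * real (?N k)"
      using elim(1) a by (subst ln_ge_iff) auto
    ultimately have "2 * ln (exp (e * real (?N k))) - ln (cmod (lead_coeff (q k)))
        - ln (cmod (lead_coeff (q k) * (\<Prod>i<?N k. w k i))) \<le> 4 * (e * real (?N k))"
      by simp
    also have "\<dots> < B e k" using e elim(5) by (simp add: B_def)
    finally have "2 * ln (exp (e * real (?N k))) - ln (cmod (lead_coeff (q k)))
        - ln (cmod (lead_coeff (q k) * (\<Prod>i<?N k. w k i))) < B e k" .
    from zeros_near_circle[OF _ a wnz exp_gt_zero S this] show ?case by blast
  qed
  have dist0: "(\<lambda>k. (\<Sum>i<?N k. \<bar>ln (cmod (w k i))\<bar>) / real (?N k)) \<longlonglongrightarrow> 0"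
    unfolding tendsto_iff
  proof (intro allI impI)
    fix r :: real assume "r > 0"
    then have "r / 10 > 0" by simp
    from ev[OF this] pos
    show "\<forall>\<^sub>F k in sequentially. dist ((\<Sum>i<?N k. \<bar>ln (cmod (w k i))\<bar>) / real (?N k)) 0 < r"
    proof eventually_elim
      case (elim k)
      then have "(\<Sum>i<?N k. \<bar>ln (cmod (w k i))\<bar>) \<le> r / 2 * real (?N k)" by (simp add: B_def)
      also have "\<dots> < r * real (?N k)" using \<open>r > 0\<close> elim by simp
      finally show ?case
        using elim by (simp add: dist_real_def sum_nonneg divide_less_eq)
    qed
  qed
  have mom: "(\<lambda>k. (\<Sum>i<?N k. cnj (sgn (w k i)) ^ m) / of_nat (?N k)) \<longlonglongrightarrow> 0" if m: "m > 0" for m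
    unfolding tendsto_iff
  proof (intro allI impI)
    fix r :: real assume "r > 0"
    define c where "c = real m * (2 * 2 ^ m + 1)"
    have c: "c > 0" using m by (simp add: c_def add_pos_pos)
    then have "r / (10 * c) > 0" using \<open>r > 0\<close> by simp
    from ev[OF this] pos
    show "\<forall>\<^sub>F k in sequentially. dist ((\<Sum>i<?N k. cnj (sgn (w k i)) ^ m) / of_nat (?N k)) 0 < r"
    proof eventually_elim
      case (elim k)
      then have "cmod (\<Sum>i<?N k. cnj (sgn (w k i)) ^ m) \<le> c * B (r / (10 * c)) k"
        using m unfolding c_def by blast
      also have "\<dots> = r / 2 * real (?N k)" using c by (simp add: B_def)
      also have "\<dots> < r * real (?N k)" using \<open>r > 0\<close> elim by simp
      finally show ?case
        using elim by (simp add: norm_divide divide_less_eq)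
    qed
  qed
  \<comment> \<open>The default 1 keeps every point on the circle for all \<open>k\<close>; for
    large \<open>k\<close> no zero is 0 and \<open>u k i\<close> is the direction of
    \<open>w k i\<close>.\<close>
  define u where "u k i = (if w k i = 0 then 1 else sgn (w k i))" for k i
  have u: "cmod (u k i) = 1" for k i by (simp add: u_def norm_sgn)
  have u_eq: "\<forall>\<^sub>F k in sequentially. \<forall>i<?N k. u k i = sgn (w k i)"
    using nz by eventually_elim (simp add: u_def)
  have mom': "(\<lambda>k. (\<Sum>i<?N k. cnj (u k i) ^ m) / of_nat (?N k)) \<longlonglongrightarrow> 0" if m: "m > 0" for m
    by (rule Lim_transform_eventually[OF mom[OF m]])
       (use u_eq in eventually_elim, simp)
  show ?thesis
    unfolding weakly_converges_def
  proof (intro allI impI, elim conjE)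
    fix g :: "complex \<Rightarrow> real"
    assume g: "continuous_on UNIV g" and "bounded (range g)"
    then obtain G where G: "\<And>z. \<bar>g z\<bar> \<le> G" by (auto simp: bounded_iff)
    have lim_u: "(\<lambda>k. (\<Sum>i<?N k. g (u k i)) / real (?N k)) \<longlonglongrightarrow> integral\<^sup>L circle_measure g"
      by (rule Weyl_criterion_circle[OF deg u mom' g])
    have "(\<lambda>k. (\<Sum>i<?N k. g (w k i)) / real (?N k) - (\<Sum>i<?N k. g (u k i)) / real (?N k)) \<longlonglongrightarrow> 0"
      unfolding tendsto_iff
    proof (intro allI impI)
      fix r :: real assume r: "r > 0"
      obtain c where c: "c > 0"
        and gc: "\<And>w. w \<noteq> 0 \<Longrightarrow> \<bar>g w - g (sgn w)\<bar> \<le> r / 2 + c * \<bar>ln (cmod w)\<bar>"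
        using continuous_sgn_bound[OF g G, of "r / 2"] r by auto
      have "\<forall>\<^sub>F k in sequentially. dist ((\<Sum>i<?N k. \<bar>ln (cmod (w k i))\<bar>) / real (?N k)) 0 < r / (2 * c)"
        using dist0 r c unfolding tendsto_iff by simp
      then show "\<forall>\<^sub>F k in sequentially. dist ((\<Sum>i<?N k. g (w k i)) / real (?N k) - (\<Sum>i<?N k. g (u k i)) / real (?N k)) 0 < r"
        using nz pos u_eq
      proof eventually_elim
        case (elim k)
        have N: "real (?N k) > 0" using elim by simp
        have "\<bar>(\<Sum>i<?N k. g (w k i)) - (\<Sum>i<?N k. g (u k i))\<bar> \<le> (\<Sum>i<?N k. \<bar>g (w k i) - g (u k i)\<bar>)"
          by (simp only: sum_subtractf[symmetric] sum_abs)
        also have "\<dots> \<le> (\<Sum>i<?N k. r / 2 + c * \<bar>ln (cmod (w k i))\<bar>)"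
          by (intro sum_mono) (use elim gc in auto)
        also have "\<dots> = r / 2 * real (?N k) + c * (\<Sum>i<?N k. \<bar>ln (cmod (w k i))\<bar>)"
          by (simp add: sum.distrib sum_distrib_left)
        also have "c * (\<Sum>i<?N k. \<bar>ln (cmod (w k i))\<bar>) < r / 2 * real (?N k)"
          using elim(1) N c by (simp add: dist_real_def sum_nonneg field_simps)
        finally show ?case
          using N by (simp add: dist_real_def diff_divide_distrib[symmetric] abs_divide divide_less_eq)
      qed
    qed
    from tendsto_add[OF this lim_u]
    have "(\<lambda>k. (\<Sum>i<?N k. g (w k i)) / real (?N k)) \<longlonglongrightarrow> integral\<^sup>L circle_measure g" by simp
    then show "(\<lambda>k. integral\<^sup>L (zero_measure (q k)) g) \<longlonglongrightarrow> integral\<^sup>L circle_measure g"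
    proof (rule Lim_transform_eventually)
      show "\<forall>\<^sub>F k in sequentially. (\<Sum>i<?N k. g (w k i)) / real (?N k) = integral\<^sup>L (zero_measure (q k)) g"
        using nz
        by eventually_elim (simp add: integral_zero_measure sum_w borel_measurable_continuous_onI[OF g])
    qed
  qed
qed

section \<open>The weighted norm of polynomials\<close>

text \<open>The norm of the space on polynomials, as a finite sum. Through \<open>L2_set\<close> it
  inherits the triangle and Cauchy-Schwarz inequalities.\<close>

definition pnorm :: "(nat \<Rightarrow> real) \<Rightarrow> complex poly \<Rightarrow> real" where
  "pnorm \<omega> q = L2_set (\<lambda>k. cmod (coeff q k) * sqrt (\<omega> k)) {..degree q}"

lemma pnorm_eq_L2_set:
  assumes "degree q \<le> n"
  shows "pnorm \<omega> q = L2_set (\<lambda>k. cmod (coeff q k) * sqrt (\<omega> k)) {..n}"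
  unfolding pnorm_def L2_set_def
  by (rule arg_cong[where f = sqrt], rule sum.mono_neutral_left)
     (use assms in \<open>auto simp: coeff_eq_0 not_le\<close>)

lemma pnorm_nonneg [simp]: "pnorm \<omega> q \<ge> 0"
  by (simp add: pnorm_def)

lemma pnorm_smult: "pnorm \<omega> (smult c q) = cmod c * pnorm \<omega> q"
  by (simp add: pnorm_eq_L2_set[of _ "degree q"] L2_set_right_distrib norm_mult mult.assoc)

lemma pnorm_one: "\<omega> 0 = 1 \<Longrightarrow> pnorm \<omega> 1 = 1"
  by (simp add: pnorm_def)

text \<open>The cyclic vectors of multiplication by \<open>z\<close>, expressed inside the space of
  polynomials.\<close>

definition cyclic_poly :: "(nat \<Rightarrow> real) \<Rightarrow> complex poly \<Rightarrow> bool" where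
  "cyclic_poly \<omega> g \<longleftrightarrow> (\<forall>e>0. \<exists>q. pnorm \<omega> (1 - q * g) < e)"

text \<open>Ties the top coefficient of \<open>1 - p * f\<close> to that of \<open>p\<close>; if
  \<open>degree p < n\<close>, both sides vanish.\<close>

lemma coeff_mult_top:
  assumes "degree p \<le> n"
  shows "coeff (p * f) (n + degree f) = coeff p n * lead_coeff f"
proof (cases "degree p = n")
  case True
  then show ?thesis using coeff_mult_degree_sum[of p f] by simp
next
  case False
  then show ?thesis
    using assms degree_mult_le[of p f] by (simp add: coeff_eq_0)
qed

context
  fixes \<omega> :: "nat \<Rightarrow> real"
  assumes pos: "\<And>k. \<omega> k > 0"
begin

lemma pnorm_power2:
  assumes "degree q \<le> n"
  shows "(pnorm \<omega> q)\<^sup>2 = (\<Sum>k\<le>n. (cmod (coeff q k))\<^sup>2 * \<omega> k)"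
  unfolding pnorm_eq_L2_set[OF assms] L2_set_def
  by (simp add: sum_nonneg power_mult_distrib less_imp_le[OF pos])

lemma H2_norm_poly: "H2_norm \<omega> (poly q) = pnorm \<omega> q"
proof -
  have "poly q has_fps_expansion fps_of_poly q"
    by (simp add: has_fps_expansion_def)
  then have "fps_expansion (poly q) 0 = fps_of_poly q"
    by (rule fps_expansion_eqI)
  then have "H2_norm \<omega> (poly q) = sqrt (\<Sum>k. (cmod (coeff q k))\<^sup>2 * \<omega> k)"
    by (simp add: H2_norm_def)
  also have "(\<Sum>k. (cmod (coeff q k))\<^sup>2 * \<omega> k) = (\<Sum>k\<le>degree q. (cmod (coeff q k))\<^sup>2 * \<omega> k)"
    by (rule suminf_finite) (auto simp: coeff_eq_0 not_le)
  also have "\<dots> = (pnorm \<omega> q)\<^sup>2" by (simp add: pnorm_power2[OF order_refl])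
  finally show ?thesis by simp
qed

lemma pnorm_triangle: "pnorm \<omega> (p + q) \<le> pnorm \<omega> p + pnorm \<omega> q"
proof -
  define n where "n = max (degree p) (degree q)"
  have d: "degree p \<le> n" "degree q \<le> n" "degree (p + q) \<le> n"
    using degree_add_le_max[of p q] by (auto simp: n_def)
  have "L2_set (\<lambda>k. cmod (coeff (p + q) k) * sqrt (\<omega> k)) {..n}
      \<le> L2_set (\<lambda>k. cmod (coeff p k) * sqrt (\<omega> k) + cmod (coeff q k) * sqrt (\<omega> k)) {..n}"
    by (rule L2_set_mono)
       (auto simp: less_imp_le[OF pos] norm_triangle_ineq mult_right_mono simp flip: distrib_right)
  also have "\<dots> \<le> L2_set (\<lambda>k. cmod (coeff p k) * sqrt (\<omega> k)) {..n}
      + L2_set (\<lambda>k. cmod (coeff q k) * sqrt (\<omega> k)) {..n}"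
    by (rule L2_set_triangle_ineq)
  finally show ?thesis by (simp only: pnorm_eq_L2_set[OF d(1)] pnorm_eq_L2_set[OF d(2)] pnorm_eq_L2_set[OF d(3)])
qed

text \<open>Cauchy-Schwarz with the factors \<open>sqrt (\<omega> k)\<close> and
  \<open>1 / sqrt (\<omega> k)\<close>. It serves both to bound residuals on the circle and, at a
  zero of \<open>f\<close>, to bound their norms from below.\<close>

lemma cmod_poly_le_pnorm:
  assumes "degree q \<le> n" and z: "cmod z = 1"
  shows "cmod (poly q z) \<le> pnorm \<omega> q * sqrt (\<Sum>k\<le>n. 1 / \<omega> k)"
proof -
  have "poly q z = (\<Sum>k\<le>n. coeff q k * z ^ k)"
    unfolding poly_altdef
    by (rule sum.mono_neutral_left) (use assms in \<open>auto simp: coeff_eq_0 not_le\<close>)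
  then have "cmod (poly q z) \<le> (\<Sum>k\<le>n. cmod (coeff q k))"
    using z by (auto intro!: sum_norm_le simp: norm_mult norm_power)
  also have "\<dots> = (\<Sum>k\<le>n. \<bar>cmod (coeff q k) * sqrt (\<omega> k)\<bar> * \<bar>1 / sqrt (\<omega> k)\<bar>)"
    using pos by (simp add: abs_mult less_imp_le less_imp_neq[THEN not_sym])
  also have "\<dots> \<le> L2_set (\<lambda>k. cmod (coeff q k) * sqrt (\<omega> k)) {..n} * L2_set (\<lambda>k. 1 / sqrt (\<omega> k)) {..n}"
    by (rule L2_set_mult_ineq)
  also have "L2_set (\<lambda>k. 1 / sqrt (\<omega> k)) {..n} = sqrt (\<Sum>k\<le>n. 1 / \<omega> k)"
    using pos by (simp add: L2_set_def power_divide less_imp_le)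
  finally show ?thesis by (simp add: pnorm_eq_L2_set[OF assms(1)])
qed

section \<open>Consequences of optimality\<close>

lemma is_opa_pnorm:
  assumes "is_opa \<omega> (poly f) n p"
  shows "degree p \<le> n" "degree q \<le> n \<Longrightarrow> pnorm \<omega> (1 - p * f) \<le> pnorm \<omega> (1 - q * f)"
proof -
  have "(\<lambda>z. 1 - poly q z * poly f z) = poly (1 - q * f)" for q :: "complex poly"
    by (simp add: fun_eq_iff)
  then show "degree p \<le> n" "degree q \<le> n \<Longrightarrow> pnorm \<omega> (1 - p * f) \<le> pnorm \<omega> (1 - q * f)"
    using assms unfolding is_opa_def by (simp_all add: H2_norm_poly)
qed

text \<open>Monomials are orthogonal, so the added constant interacts only with the coefficient of
  index 0, whose weight is 1.\<close>

lemma pnorm_power2_affine: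
  assumes "\<omega> 0 = 1"
  shows "(pnorm \<omega> (smult (of_real s) q + [:of_real t:]))\<^sup>2
    = s\<^sup>2 * (pnorm \<omega> q)\<^sup>2 + 2 * s * t * Re (coeff q 0) + t\<^sup>2"
proof -
  define n where "n = degree q"
  have d: "degree (smult (of_real s) q + [:of_real t:]) \<le> n"
    by (rule degree_add_le) (auto simp: n_def)
  have split: "(\<Sum>k\<le>n. f k) = f 0 + (\<Sum>k\<in>{1..n}. f k)" for f :: "nat \<Rightarrow> real"
    by (simp add: sum.atLeast_Suc_atMost atMost_atLeast0)
  have c0: "(cmod (coeff (smult (of_real s) q + [:of_real t:]) 0))\<^sup>2
      = s\<^sup>2 * (cmod (coeff q 0))\<^sup>2 + 2 * s * t * Re (coeff q 0) + t\<^sup>2"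
    unfolding cmod_power2 by (simp add: power2_eq_square algebra_simps)
  have "(\<Sum>k\<in>{1..n}. (cmod (coeff (smult (of_real s) q + [:of_real t:]) k))\<^sup>2 * \<omega> k)
      = (\<Sum>k\<in>{1..n}. s\<^sup>2 * ((cmod (coeff q k))\<^sup>2 * \<omega> k))"
    by (rule sum.cong) (auto simp: coeff_pCons norm_mult power_mult_distrib split: nat.split)
  then show ?thesis
    unfolding pnorm_power2[OF d] pnorm_power2[of q n, OF eq_refl[OF n_def[symmetric]]] split
    by (simp only: c0 assms sum_distrib_left[symmetric] distrib_left mult_1_right)
qed

text \<open>Optimality of \<open>p\<close> among the multiples \<open>(1 - t) p\<close>.\<close>

lemma opa_const_coeff:
  assumes opa: "is_opa \<omega> (poly f) n p" and \<omega>0: "\<omega> 0 = 1"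
  shows "(pnorm \<omega> (1 - p * f))\<^sup>2 \<le> Re (coeff (1 - p * f) 0)"
proof (rule ccontr)
  define R where "R = 1 - p * f"
  define \<rho> where "\<rho> = (pnorm \<omega> R)\<^sup>2"
  define \<delta> where "\<delta> = \<rho> - Re (coeff R 0)"
  define c where "c = \<rho> - 2 * Re (coeff R 0) + 1"
  assume "\<not> (pnorm \<omega> (1 - p * f))\<^sup>2 \<le> Re (coeff (1 - p * f) 0)"
  then have \<delta>: "\<delta> > 0" by (simp add: \<delta>_def \<rho>_def R_def)
  \<comment> \<open>The variation changes the squared norm by
    \<open>t * (t * c - 2 * \<delta>)\<close>. This \<open>t\<close> is small enough that
    \<open>t * c \<le> \<delta>\<close>, so the norm would strictly decrease.\<close>
  define t where "t = \<delta> / (\<bar>c\<bar> + 1)"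
  have t: "t > 0" using \<delta> by (simp add: t_def)
  have "pnorm \<omega> R \<le> pnorm \<omega> (1 - smult (of_real (1 - t)) p * f)"
    unfolding R_def by (rule is_opa_pnorm(2)[OF opa]) (use is_opa_pnorm(1)[OF opa] in simp)
  also have "1 - smult (of_real (1 - t)) p * f = smult (of_real (1 - t)) R + [:of_real t:]"
  proof -
    have "[:of_real t:] = smult (of_real t) (1 :: complex poly)" by (simp add: one_pCons)
    then show ?thesis by (simp add: R_def smult_diff_left smult_diff_right left_diff_distrib)
  qed
  finally have "\<rho> \<le> (pnorm \<omega> (smult (of_real (1 - t)) R + [:of_real t:]))\<^sup>2"
    unfolding \<rho>_def by (intro power_mono) auto
  also have "\<dots> = (1 - t)\<^sup>2 * \<rho> + 2 * (1 - t) * t * Re (coeff R 0) + t\<^sup>2"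
    unfolding \<rho>_def by (rule pnorm_power2_affine[OF \<omega>0])
  also have "\<dots> = \<rho> + t * (t * c - 2 * \<delta>)"
    by (simp add: c_def \<delta>_def power2_eq_square algebra_simps)
  finally have "2 * \<delta> \<le> t * c" using t by (simp add: zero_le_mult_iff)
  also have "t * c \<le> t * (\<bar>c\<bar> + 1)" using t by (intro mult_left_mono) auto
  also have "\<dots> = \<delta>" by (simp add: t_def)
  finally show False using \<delta> by simp
qed

text \<open>Removing the top coefficient of \<open>p\<close> yields a competitor of degree \<open>n\<close>.\<close>

lemma opa_pnorm_step:
  assumes opa: "is_opa \<omega> (poly f) n p'" "is_opa \<omega> (poly f) (Suc n) p" and f: "f \<noteq> 0"
  shows "pnorm \<omega> (1 - p' * f) \<le> pnorm \<omega> (1 - p * f)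
    + cmod (coeff (1 - p * f) (Suc n + degree f)) * (pnorm \<omega> (f * monom 1 (Suc n)) / cmod (lead_coeff f))"
proof -
  define b where "b = coeff p (Suc n)"
  define q where "q = p - monom b (Suc n)"
  have p: "degree p \<le> Suc n" by (rule is_opa_pnorm(1)[OF opa(2)])
  have "degree q \<le> n"
  proof (rule degree_le, intro allI impI)
    fix i assume "i > n"
    then show "coeff q i = 0"
      using p by (cases "i = Suc n") (auto simp: q_def b_def coeff_eq_0)
  qed
  then have "pnorm \<omega> (1 - p' * f) \<le> pnorm \<omega> (1 - q * f)"
    by (rule is_opa_pnorm(2)[OF opa(1)])
  also have "1 - q * f = (1 - p * f) + smult b (f * monom 1 (Suc n))"
    by (simp add: q_def left_diff_distrib smult_monom mult.commute[of f] flip: mult_smult_left)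
  also have "pnorm \<omega> \<dots> \<le> pnorm \<omega> (1 - p * f) + cmod b * pnorm \<omega> (f * monom 1 (Suc n))"
    using pnorm_triangle[of "1 - p * f" "smult b (f * monom 1 (Suc n))"] by (simp add: pnorm_smult)
  also have "cmod b = cmod (coeff (1 - p * f) (Suc n + degree f)) / cmod (lead_coeff f)"
    using coeff_mult_top[OF p, of f] f by (simp add: b_def norm_mult)
  finally show ?thesis by simp
qed

section \<open>Cyclicity of polynomials without zeros in the disc\<close>

text \<open>Multiplication by \<open>z\<close> has norm at most \<open>sqrt C\<close> by the bound
  on weight ratios; Horner's scheme extends boundedness to any polynomial multiplier.\<close>

lemma pnorm_mult_bounded:
  assumes ratio: "\<And>k. \<omega> (Suc k) \<le> C * \<omega> k"
  shows "\<exists>D\<ge>0. \<forall>h. pnorm \<omega> (g * h) \<le> D * pnorm \<omega> h"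
proof (induction g)
  case 0
  show ?case by (intro exI[of _ 0]) (simp add: pnorm_def)
next
  case (pCons a g)
  then obtain D where D: "D \<ge> 0" "\<And>h. pnorm \<omega> (g * h) \<le> D * pnorm \<omega> h" by blast
  have C: "C \<ge> 0" using ratio[of 0] pos[of 0] pos[of 1]
    by (metis One_nat_def less_le_trans linorder_not_less mult_neg_pos not_less_iff_gr_or_eq order_less_imp_le)
  have shift: "pnorm \<omega> (pCons 0 h) \<le> sqrt C * pnorm \<omega> h" for h
  proof -
    have "(pnorm \<omega> (pCons 0 h))\<^sup>2 = (\<Sum>k\<le>Suc (degree h). (cmod (coeff (pCons 0 h) k))\<^sup>2 * \<omega> k)"
      by (rule pnorm_power2) (simp add: degree_pCons_le)
    also have "\<dots> = (\<Sum>k\<le>degree h. (cmod (coeff h k))\<^sup>2 * \<omega> (Suc k))"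
      by (subst sum.atMost_Suc_shift) simp
    also have "\<dots> \<le> (\<Sum>k\<le>degree h. (cmod (coeff h k))\<^sup>2 * (C * \<omega> k))"
      by (intro sum_mono mult_left_mono ratio) simp
    also have "\<dots> = C * (pnorm \<omega> h)\<^sup>2"
      by (simp add: pnorm_power2[OF order_refl] sum_distrib_left mult_ac)
    finally have "sqrt ((pnorm \<omega> (pCons 0 h))\<^sup>2) \<le> sqrt (C * (pnorm \<omega> h)\<^sup>2)" by (rule real_sqrt_le_mono)
    then show ?thesis by (simp add: real_sqrt_mult)
  qed
  have "pnorm \<omega> (pCons a g * h) \<le> (cmod a + sqrt C * D) * pnorm \<omega> h" for h
  proof -
    have "pnorm \<omega> (pCons a g * h) \<le> pnorm \<omega> (smult a h) + pnorm \<omega> (pCons 0 (g * h))"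
      unfolding mult_pCons_left by (rule pnorm_triangle)
    also have "\<dots> \<le> cmod a * pnorm \<omega> h + sqrt C * (D * pnorm \<omega> h)"
      by (intro add_mono order_trans[OF shift] mult_left_mono D) (simp_all add: pnorm_smult C)
    finally show ?thesis by (simp add: algebra_simps)
  qed
  then show ?case using D C by (intro exI[of _ "cmod a + sqrt C * D"]) simp
qed

lemma cyclic_poly_const: "c \<noteq> 0 \<Longrightarrow> cyclic_poly \<omega> [:c:]"
  unfolding cyclic_poly_def by (intro allI impI exI[of _ "[:1 / c:]"]) (simp add: pnorm_def one_pCons)

text \<open>First \<open>q2\<close> is chosen for \<open>g2\<close>. Then multiplication by
  \<open>q2 * g2\<close> is bounded, and \<open>q1\<close> is chosen for \<open>g1\<close> with a
  tolerance adapted to that bound.\<close>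

lemma cyclic_poly_mult:
  assumes ratio: "\<And>k. \<omega> (Suc k) \<le> C * \<omega> k" and g: "cyclic_poly \<omega> g1" "cyclic_poly \<omega> g2"
  shows "cyclic_poly \<omega> (g1 * g2)"
  unfolding cyclic_poly_def
proof (intro allI impI)
  fix e :: real assume "e > 0"
  then obtain q2 where q2: "pnorm \<omega> (1 - q2 * g2) < e / 2"
    using g(2) unfolding cyclic_poly_def by (meson half_gt_zero)
  obtain D where D: "D \<ge> 0" "\<And>h. pnorm \<omega> ((q2 * g2) * h) \<le> D * pnorm \<omega> h"
    using pnorm_mult_bounded[OF ratio] by blast
  have "e / (2 * (D + 1)) > 0" using \<open>e > 0\<close> D by simp
  then obtain q1 where q1: "pnorm \<omega> (1 - q1 * g1) < e / (2 * (D + 1))"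
    using g(1) unfolding cyclic_poly_def by blast
  have "1 - (q1 * q2) * (g1 * g2) = (1 - q2 * g2) + (q2 * g2) * (1 - q1 * g1)"
    by (simp add: algebra_simps)
  then have "pnorm \<omega> (1 - (q1 * q2) * (g1 * g2))
      \<le> pnorm \<omega> (1 - q2 * g2) + pnorm \<omega> ((q2 * g2) * (1 - q1 * g1))"
    by (simp only: pnorm_triangle)
  also have "pnorm \<omega> ((q2 * g2) * (1 - q1 * g1)) \<le> D * (e / (2 * (D + 1)))"
    using q1 D by (meson less_imp_le mult_left_mono order_trans)
  also have "\<dots> \<le> e / 2" using \<open>e > 0\<close> D(1) by (simp add: field_simps)
  finally show "\<exists>q. pnorm \<omega> (1 - q * (g1 * g2)) < e" using q2 by (intro exI[of _ "q1 * q2"]) simp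
qed

text \<open>The competitor is the reproducing kernel at \<open>x\<close> of the polynomials of degree at most \<open>m\<close>,
  normalised to take the value 1 at \<open>x\<close>.\<close>

lemma cyclic_poly_linear:
  assumes div: "filterlim (\<lambda>n. \<Sum>k\<le>n. 1 / \<omega> k) at_top sequentially" and x: "cmod x \<ge> 1"
  shows "cyclic_poly \<omega> [:- x, 1:]"
  unfolding cyclic_poly_def
proof (intro allI impI)
  fix e :: real assume e: "e > 0"
  obtain m where m: "(\<Sum>k\<le>m. 1 / \<omega> k) > 1 / e\<^sup>2"
    using div[unfolded filterlim_at_top_dense, rule_format, of "1 / e\<^sup>2"]
    by (auto simp: eventually_sequentially)
  define S where "S = (\<Sum>k\<le>m. (cmod x) ^ (2 * k) / \<omega> k)"
  have "(\<Sum>k\<le>m. 1 / \<omega> k) \<le> S"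
    unfolding S_def using x pos by (intro sum_mono divide_right_mono) (auto simp: less_imp_le)
  with m have S: "S > 1 / e\<^sup>2" by simp
  moreover have "1 / e\<^sup>2 > 0" using e by simp
  ultimately have S0: "S > 0" by linarith
  define Q where "Q = (\<Sum>k\<le>m. monom (cnj x ^ k / of_real (\<omega> k * S)) k)"
  have cQ: "coeff Q k = (if k \<le> m then cnj x ^ k / of_real (\<omega> k * S) else 0)" for k
    by (simp add: Q_def coeff_sum)
  have dQ: "degree Q \<le> m" by (rule degree_le) (simp add: cQ)
  have "poly Q x = (\<Sum>k\<le>m. of_real ((cmod x) ^ (2 * k) / \<omega> k / S))"
    unfolding Q_def poly_sum
  proof (rule sum.cong)
    fix k
    have "cnj x ^ k * x ^ k = of_real ((cmod x) ^ (2 * k))"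
      by (simp add: power_mult_distrib[symmetric] complex_norm_square[symmetric] mult.commute[of "cnj x"] power_mult)
    then show "poly (monom (cnj x ^ k / of_real (\<omega> k * S)) k) x = of_real ((cmod x) ^ (2 * k) / \<omega> k / S)"
      by (simp add: poly_monom)
  qed simp
  also have "\<dots> = of_real (S / S)" unfolding of_real_sum[symmetric] sum_divide_distrib[symmetric] S_def ..
  finally have "poly (1 - Q) x = 0" using S0 by simp
  \<comment> \<open>Since \<open>1 - Q\<close> vanishes at \<open>x\<close>, it is a multiple of the
    linear factor, and \<open>Q\<close> is the remaining error, of squared norm
    \<open>1 / S\<close>.\<close>
  then obtain q where q: "1 - Q = q * [:- x, 1:]"
    unfolding poly_eq_0_iff_dvd by (metis dvdE mult.commute)
  have "(pnorm \<omega> Q)\<^sup>2 = (\<Sum>k\<le>m. (cmod x) ^ (2 * k) / \<omega> k / S\<^sup>2)"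
    unfolding pnorm_power2[OF dQ]
    using pos S0 by (intro sum.cong)
      (auto simp: cQ norm_divide norm_power norm_mult abs_mult power_divide power_mult_distrib
         power2_eq_square power_mult[symmetric] field_simps power_add[symmetric] mult_2_right less_imp_neq[THEN not_sym])
  also have "\<dots> = 1 / S"
    using S0 unfolding sum_divide_distrib[symmetric] S_def[symmetric] by (simp add: power2_eq_square)
  also have "\<dots> < e\<^sup>2" using S S0 e by (simp add: field_simps)
  finally have "pnorm \<omega> Q < e" using e by (simp add: power_less_imp_less_base)
  moreover have "Q = 1 - q * [:- x, 1:]" using q by (simp add: algebra_simps)
  ultimately show "\<exists>q. pnorm \<omega> (1 - q * [:- x, 1:]) < e" by blast
qed

text \<open>All zeros have modulus at least 1, so each linear factor is cyclic, and cyclicity passes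
  to products.\<close>

lemma cyclic_poly_no_zeros_in_disc:
  assumes ratio: "\<And>k. \<omega> (Suc k) \<le> C * \<omega> k"
    and div: "filterlim (\<lambda>n. \<Sum>k\<le>n. 1 / \<omega> k) at_top sequentially"
    and f: "f \<noteq> 0" "\<And>z. cmod z < 1 \<Longrightarrow> poly f z \<noteq> 0"
  shows "cyclic_poly \<omega> f"
proof -
  obtain w where w: "f = smult (lead_coeff f) (\<Prod>i<degree f. [:- w i, 1:])"
    using complex_poly_roots_enum[OF f(1)] by auto
  have root: "cmod (w i) \<ge> 1" if "i < degree f" for i
  proof -
    have "poly f (w i) = 0"
      using arg_cong[OF w, of "\<lambda>p. poly p (w i)"] that by (auto simp: poly_prod)
    then show ?thesis using f(2) by force
  qed
  have "cyclic_poly \<omega> (\<Prod>i<n. [:- w i, 1:])" if "n \<le> degree f" for n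
    using that
  proof (induction n)
    case 0
    show ?case using cyclic_poly_const[of 1] by (simp add: one_pCons)
  next
    case (Suc n)
    then show ?case
      unfolding prod.lessThan_Suc
      by (intro cyclic_poly_mult[OF ratio] cyclic_poly_linear[OF div] root) auto
  qed
  then have "cyclic_poly \<omega> ([:lead_coeff f:] * (\<Prod>i<degree f. [:- w i, 1:]))"
    using f(1) by (intro cyclic_poly_mult[OF ratio] cyclic_poly_const) auto
  then show ?thesis using w by simp
qed

end

section \<open>Growth of weights\<close>

lemma exp_growth_bound:
  fixes x :: "nat \<Rightarrow> real"
  assumes pos: "\<And>n. x n > 0" and e: "e > 0"
    and ev: "\<forall>\<^sub>F n in sequentially. x (Suc n) \<le> exp e * x n"
  obtains C where "C > 0" "\<And>n. x n \<le> C * exp (e * real n)"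
proof -
  obtain n0 where n0: "\<And>n. n \<ge> n0 \<Longrightarrow> x (Suc n) \<le> exp e * x n"
    using ev by (auto simp: eventually_sequentially)
  define C where "C = Max (x ` {..n0})"
  have le: "x n \<le> C" if "n \<le> n0" for n
    unfolding C_def using that by (intro Max_ge) auto
  have C: "C > 0" using le[of 0] pos[of 0] by simp
  have "x n \<le> C * exp (e * real n)" for n
  proof (induction n)
    case 0
    show ?case using le[of 0] by simp
  next
    case (Suc n)
    show ?case
    proof (cases "Suc n \<le> n0")
      case True
      have "C * 1 \<le> C * exp (e * real (Suc n))"
        using C e by (intro mult_left_mono) auto
      then show ?thesis using le[OF True] by simp
    next
      case False
      then have "x (Suc n) \<le> exp e * x n" by (intro n0) auto
      also have "\<dots> \<le> exp e * (C * exp (e * real n))"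
        by (intro mult_left_mono Suc.IH) auto
      also have "\<dots> = C * exp (e * real (Suc n))"
        by (simp add: exp_add algebra_simps)
      finally show ?thesis .
    qed
  qed
  with C show ?thesis by (rule that)
qed

text \<open>By monotonicity \<open>\<omega> n\<close> lies between
  \<open>\<omega> (s (Suc n))\<close> and \<open>\<omega> (Suc n)\<close>, so the one-step ratio is
  at least as close to 1 as the ratio over the longer gap.\<close>

lemma weight_ratio_tendsto:
  assumes "is_weight \<omega>"
  shows "(\<lambda>n. \<omega> (Suc n) / \<omega> n) \<longlonglongrightarrow> 1"
proof -
  define s where "s n = n - nat \<lfloor>sqrt (real n)\<rfloor>" for n
  have pos: "\<omega> k > 0" for k using assms by (simp add: is_weight_def)
  have lim: "(\<lambda>n. \<omega> n / \<omega> (s n)) \<longlonglongrightarrow> 1"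
    using assms by (simp add: is_weight_def s_def)
  have s: "s (Suc n) \<le> n" for n
  proof -
    have "nat \<lfloor>sqrt (real (Suc n))\<rfloor> \<ge> 1" by (simp add: le_nat_iff le_floor_iff)
    then show ?thesis unfolding s_def by linarith
  qed
  have bound: "\<bar>\<omega> (Suc n) / \<omega> n - 1\<bar> \<le> \<bar>\<omega> (Suc n) / \<omega> (s (Suc n)) - 1\<bar>" for n
  proof (cases "mono \<omega>")
    case True
    have "\<omega> (s (Suc n)) \<le> \<omega> n" "\<omega> n \<le> \<omega> (Suc n)"
      using True s[of n] by (auto simp: mono_def)
    then have "1 \<le> \<omega> (Suc n) / \<omega> n" "\<omega> (Suc n) / \<omega> n \<le> \<omega> (Suc n) / \<omega> (s (Suc n))"
      using pos[of n] pos[of "s (Suc n)"] pos[of "Suc n"] by (auto intro!: divide_left_mono)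
    then show ?thesis by linarith
  next
    case False
    then have anti: "antimono \<omega>" using assms by (simp add: is_weight_def)
    have "\<omega> (s (Suc n)) \<ge> \<omega> n" "\<omega> n \<ge> \<omega> (Suc n)"
      using anti s[of n] by (auto simp: antimono_def)
    then have "1 \<ge> \<omega> (Suc n) / \<omega> n" "\<omega> (Suc n) / \<omega> n \<ge> \<omega> (Suc n) / \<omega> (s (Suc n))"
      using pos[of n] pos[of "s (Suc n)"] pos[of "Suc n"] by (auto intro!: divide_left_mono)
    then show ?thesis by linarith
  qed
  have "(\<lambda>n. \<bar>\<omega> (Suc n) / \<omega> (s (Suc n)) - 1\<bar>) \<longlonglongrightarrow> 0"
    using LIMSEQ_Suc[OF lim] by (intro tendsto_rabs_zero) (simp add: LIM_zero)
  then have "(\<lambda>n. \<bar>\<omega> (Suc n) / \<omega> n - 1\<bar>) \<longlonglongrightarrow> 0"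
    by (rule tendsto_sandwich[OF _ _ tendsto_const, rotated 2]) (use bound in auto)
  then show ?thesis
    using LIM_zero_iff tendsto_rabs_zero_iff by blast
qed

text \<open>Consecutive ratios of both \<open>\<omega>\<close> and its reciprocal tend to 1, so each
  grows more slowly than any exponential.\<close>

lemma weight_exp_bounds:
  assumes w: "is_weight \<omega>" and e: "e > 0"
  obtains C where "C > 0" "\<And>n. \<omega> n \<le> C * exp (e * real n)" "\<And>n. 1 / \<omega> n \<le> C * exp (e * real n)"
proof -
  have pos: "\<omega> k > 0" for k using w by (simp add: is_weight_def)
  note lim = weight_ratio_tendsto[OF w]
  have "exp e > 1" using e by simp
  from order_tendstoD(2)[OF lim this]
  have "\<forall>\<^sub>F n in sequentially. \<omega> (Suc n) \<le> exp e * \<omega> n"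
    by eventually_elim (simp add: pos divide_less_eq less_imp_le)
  from exp_growth_bound[OF pos e this] obtain C1
    where C1: "C1 > 0" "\<And>n. \<omega> n \<le> C1 * exp (e * real n)" by blast
  have "exp (- e) < 1" using e by simp
  from order_tendstoD(1)[OF lim this]
  have "\<forall>\<^sub>F n in sequentially. 1 / \<omega> (Suc n) \<le> exp e * (1 / \<omega> n)"
    by eventually_elim (use pos in \<open>simp add: exp_minus field_simps less_imp_le\<close>)
  from exp_growth_bound[OF _ e this] pos obtain C2
    where C2: "C2 > 0" "\<And>n. 1 / \<omega> n \<le> C2 * exp (e * real n)" by auto
  show ?thesis
  proof (rule that[of "C1 + C2"])
    fix n
    show "\<omega> n \<le> (C1 + C2) * exp (e * real n)" "1 / \<omega> n \<le> (C1 + C2) * exp (e * real n)"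
      using C1 C2 by (auto simp: algebra_simps intro: order_trans[OF C1(2)] order_trans[OF C2(2)])
  qed (use C1 C2 in simp)
qed

lemma weight_sum_subexponential:
  assumes w: "is_weight \<omega>" and e: "e > 0"
  shows "\<forall>\<^sub>F n in sequentially. (\<Sum>k\<le>n. 1 / \<omega> k) \<le> exp (e * real n)"
proof -
  have e2: "e / 2 > 0" using e by simp
  obtain C where C: "C > 0" "\<And>n. 1 / \<omega> n \<le> C * exp (e / 2 * real n)"
    by (rule weight_exp_bounds[OF w e2]) (rule that)
  have "\<forall>\<^sub>F n in sequentially. (real n + 1) * (C * exp (e / 2 * real n)) \<le> exp (e * real n)"
    using e C(1) by real_asymp
  then show ?thesis
  proof eventually_elim
    case (elim n)
    have "(\<Sum>k\<le>n. 1 / \<omega> k) \<le> (\<Sum>k\<le>n. C * exp (e / 2 * real n))"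
      using C e by (intro sum_mono order_trans[OF C(2)]) auto
    also have "\<dots> = (real n + 1) * (C * exp (e / 2 * real n))" by simp
    finally show ?case using elim by linarith
  qed
qed

section \<open>Selecting the subsequence\<close>

text \<open>Otherwise the decrements of \<open>\<rho>\<close> are eventually bounded by a geometric
  sequence. Summing them to the limit 0 makes \<open>\<rho>\<close> itself exponentially small,
  against \<open>slow\<close>.\<close>

lemma frequently_large_increment:
  fixes \<rho> a b :: "nat \<Rightarrow> real"
  assumes lim: "\<rho> \<longlonglongrightarrow> 0"
    and step: "\<And>n. \<rho> n \<le> \<rho> (Suc n) + a (Suc n) * b (Suc n)" and a: "\<And>n. a n \<ge> 0"
    and slow: "\<And>e. e > 0 \<Longrightarrow> \<forall>\<^sub>F n in sequentially. exp (- e * real n) \<le> \<rho> n"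
    and b: "\<And>e. e > 0 \<Longrightarrow> \<forall>\<^sub>F n in sequentially. b n \<le> exp (e * real n)"
    and e: "e > 0"
  shows "\<exists>\<^sub>F n in sequentially. exp (- e * real n) \<le> a n"
proof (rule ccontr)
  assume "\<not> ?thesis"
  then have "\<forall>\<^sub>F n in sequentially. a n < exp (- e * real n)"
    by (simp add: not_frequently not_le)
  moreover have "\<forall>\<^sub>F n in sequentially. b n \<le> exp (e / 2 * real n)"
    by (rule b) (use e in simp)
  ultimately have "\<forall>\<^sub>F n in sequentially. a n * b n \<le> exp (- e / 2) ^ n"
  proof eventually_elim
    case (elim n)
    have "a n * b n \<le> a n * exp (e / 2 * real n)"
      by (rule mult_left_mono) (use elim a in auto)
    also have "\<dots> \<le> exp (- e * real n) * exp (e / 2 * real n)"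
      by (rule mult_right_mono) (use elim in auto)
    also have "\<dots> = exp (- e / 2) ^ n"
      by (simp add: exp_add[symmetric] exp_of_nat_mult[symmetric] algebra_simps)
    finally show ?case .
  qed
  then obtain n0 where n0: "\<And>n. n \<ge> n0 \<Longrightarrow> a n * b n \<le> exp (- e / 2) ^ n"
    by (auto simp: eventually_sequentially)
  define x where "x = exp (- e / 2)"
  have x: "0 < x" "x < 1" using e by (simp_all add: x_def)
  \<comment> \<open>\<open>K * x ^ n\<close> is the geometric tail beyond index \<open>n\<close>.
    Subtracting it from \<open>\<rho>\<close> gives an eventually increasing sequence with limit 0,
    which is therefore eventually nonpositive.\<close>
  define K where "K = x / (1 - x)"
  have K: "K > 0" using x by (simp add: K_def)
  define \<sigma> where "\<sigma> n = \<rho> n - K * x ^ n" for n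
  have \<sigma>_step: "\<sigma> n \<le> \<sigma> (Suc n)" if "n \<ge> n0" for n
  proof -
    have "K * x ^ n - K * x ^ Suc n = K * (1 - x) * x ^ n" by (simp add: algebra_simps)
    also have "K * (1 - x) = x" using x by (simp add: K_def)
    finally show ?thesis
      using step[of n] n0[of "Suc n"] that by (simp add: \<sigma>_def x_def)
  qed
  have "\<sigma> \<longlonglongrightarrow> 0 - K * 0"
    unfolding \<sigma>_def using x by (intro tendsto_intros lim LIMSEQ_power_zero) auto
  then have "(\<lambda>m. \<sigma> (m + n0)) \<longlonglongrightarrow> 0" by (simp add: LIMSEQ_ignore_initial_segment)
  moreover have "incseq (\<lambda>m. \<sigma> (m + n0))"
    by (rule incseq_SucI) (simp add: \<sigma>_step)
  ultimately have "\<sigma> (m + n0) \<le> 0" for m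
    using incseq_le by blast
  then have "\<forall>\<^sub>F n in sequentially. \<rho> n \<le> K * exp (- e / 2 * real n)"
    unfolding eventually_sequentially
    by (intro exI[of _ n0] allI impI)
       (metis le_add_diff_inverse2 \<sigma>_def diff_le_0_iff_le x_def exp_of_nat_mult mult.commute)
  moreover have "\<forall>\<^sub>F n in sequentially. exp (- (e / 4) * real n) \<le> \<rho> n"
    by (rule slow) (use e in simp)
  moreover have "\<forall>\<^sub>F n in sequentially. K * exp (- e / 2 * real n) < exp (- (e / 4) * real n)"
    using e K by real_asymp
  ultimately have "\<forall>\<^sub>F n in sequentially. False"
    by eventually_elim linarith
  then show False by simp
qed

lemma frequently_diagonal_subseq:
  assumes "\<And>j :: nat. \<exists>\<^sub>F n in sequentially. P j n"
  obtains r :: "nat \<Rightarrow> nat" where "strict_mono r" "\<And>j. P j (r j)"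
proof -
  have "\<exists>n>m. P j n" for j m
    using assms[of j] unfolding frequently_sequentially by (meson Suc_le_eq)
  then have "\<exists>r. \<forall>j. P j (r j) \<and> r j < r (Suc j)"
    by (intro dependent_nat_choice) auto
  then show ?thesis using that by (auto simp: strict_mono_Suc_iff)
qed

section \<open>Residuals of the optimal approximants\<close>

theorem theorem1p3:
  fixes \<omega> :: "nat \<Rightarrow> real" and f :: "complex poly" and p :: "nat \<Rightarrow> complex poly"
  assumes "is_weight \<omega>"
    and "critical f"
    and "\<forall>z. poly f z = 0 \<longrightarrow> order z f = 1"
    and "\<forall>n. is_opa \<omega> (poly f) n (p n)"
  shows "\<exists>r :: nat \<Rightarrow> nat. strict_mono r \<and>
           weakly_converges (\<lambda>k. zero_measure (1 - p (r k) * f)) circle_measure"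
proof -
  note w = assms(1)
  have pos: "\<omega> k > 0" for k using w by (simp add: is_weight_def)
  have \<omega>0: "\<omega> 0 = 1" using w by (simp add: is_weight_def)
  have opa: "is_opa \<omega> (poly f) n (p n)" for n using assms(4) by simp
  have deg_p: "degree (p n) \<le> n" for n by (rule is_opa_pnorm(1)[OF pos opa])
  have f_disc: "poly f z \<noteq> 0" if "cmod z < 1" for z
    using assms(2) that by (simp add: critical_def)
  have f: "f \<noteq> 0" using f_disc[of 0] by auto
  obtain z1 where z1: "cmod z1 = 1" "poly f z1 = 0"
    using assms(2) by (auto simp: critical_def)
  define d where "d = degree f"
  define R where "R n = 1 - p n * f" for n
  define \<rho> where "\<rho> n = pnorm \<omega> (R n)" for n
  define S where "S n = (\<Sum>k\<le>n. 1 / \<omega> k)" for n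
  \<comment> \<open>The degree of \<open>R n\<close> may be smaller than \<open>n + d\<close>, so
    \<open>a n\<close> may vanish; it is the modulus of the leading coefficient only when it is
    nonzero.\<close>
  define a where "a n = cmod (coeff (R n) (n + d))" for n
  define b where "b n = pnorm \<omega> (f * monom 1 n) / cmod (lead_coeff f)" for n
  have deg_R: "degree (R n) \<le> n + d" for n
    unfolding R_def d_def using deg_p[of n] degree_mult_le[of "p n" f]
    by (intro degree_diff_le) auto
  have S_pos: "S n > 0" for n unfolding S_def using pos by (intro sum_pos) auto

  have div: "filterlim (\<lambda>n. \<Sum>k\<le>n. 1 / \<omega> k) at_top sequentially"
  proof (rule filterlim_at_top_mono)
    show "filterlim (\<lambda>n. \<Sum>k=1..n. 1 / \<omega> k) at_top sequentially"
      using w by (simp add: is_weight_def)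
    show "\<forall>\<^sub>F n in sequentially. (\<Sum>k=1..n. 1 / \<omega> k) \<le> (\<Sum>k\<le>n. 1 / \<omega> k)"
      by (intro always_eventually allI sum_mono2) (auto simp: less_imp_le[OF pos])
  qed
  have "Bseq (\<lambda>n. \<omega> (Suc n) / \<omega> n)"
    using weight_ratio_tendsto[OF w] by (intro convergent_imp_Bseq) (auto simp: convergent_def)
  then obtain C where C: "\<And>n. norm (\<omega> (Suc n) / \<omega> n) \<le> C" by (auto simp: Bseq_def)
  have ratio: "\<omega> (Suc n) \<le> C * \<omega> n" for n
    using C[of n] pos by (simp add: abs_of_pos divide_le_eq)

  \<comment> \<open>Since \<open>f\<close> is cyclic, some fixed \<open>q\<close> gives a small
    residual, and \<open>p n\<close> does at least as well once
    \<open>n \<ge> degree q\<close>.\<close>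
  have \<rho>_lim: "\<rho> \<longlonglongrightarrow> 0"
  proof (rule LIMSEQ_I)
    fix e :: real assume "e > 0"
    then obtain q where q: "pnorm \<omega> (1 - q * f) < e"
      using cyclic_poly_no_zeros_in_disc[of \<omega>, OF pos ratio div f f_disc]
      unfolding cyclic_poly_def by blast
    have "norm (\<rho> n - 0) < e" if "n \<ge> degree q" for n
      using is_opa_pnorm(2)[OF pos opa that] q by (simp add: \<rho>_def R_def)
    then show "\<exists>no. \<forall>n\<ge>no. norm (\<rho> n - 0) < e" by blast
  qed
  have \<rho>_le: "\<rho> n \<le> 1" for n
    using is_opa_pnorm(2)[OF pos opa, of 0 n] pnorm_one[of \<omega>, OF \<omega>0] by (simp add: \<rho>_def R_def)
  have \<rho>_step: "\<rho> n \<le> \<rho> (Suc n) + a (Suc n) * b (Suc n)" for n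
    unfolding \<rho>_def R_def a_def b_def d_def by (rule opa_pnorm_step[OF pos opa opa f])
  have S_ev: "\<forall>\<^sub>F n in sequentially. S (n + d) \<le> exp (e * real n)" if "e > 0" for e
  proof -
    have "e / 2 > 0" using that by simp
    from weight_sum_subexponential[OF w this]
    have "\<forall>\<^sub>F n in sequentially. S (n + d) \<le> exp (e / 2 * real (n + d))"
      unfolding S_def by (rule sequentially_offset)
    then show ?thesis
      using eventually_ge_at_top[of d]
    proof eventually_elim
      case (elim n)
      have "e / 2 * real (n + d) \<le> e * real n" using elim that by simp
      then show ?case using elim by (meson exp_le_cancel_iff order_trans)
    qed
  qed
  \<comment> \<open>At the zero \<open>z1\<close> on the circle \<open>R n\<close> equals 1, so
    \<open>\<rho> n\<close> is at least \<open>1 / sqrt (S (n + d))\<close>. The square root allows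
    the rate \<open>2 * e\<close> for \<open>S\<close>.\<close>
  have \<rho>_ge: "\<forall>\<^sub>F n in sequentially. exp (- e * real n) \<le> \<rho> n" if "e > 0" for e
  proof -
    have "2 * e > 0" using that by simp
    from S_ev[OF this] show ?thesis
    proof eventually_elim
      case (elim n)
      have "1 = cmod (poly (R n) z1)" using z1 by (simp add: R_def)
      also have "\<dots> \<le> \<rho> n * sqrt (S (n + d))"
        unfolding \<rho>_def S_def by (rule cmod_poly_le_pnorm[OF pos deg_R z1(1)])
      also have "\<dots> \<le> \<rho> n * sqrt ((exp (e * real n))\<^sup>2)"
        using elim by (intro mult_left_mono) (auto simp: \<rho>_def exp_double[symmetric] mult.assoc)
      finally show ?case by (simp add: exp_minus field_simps)
    qed
  qed
  \<comment> \<open>Multiplication by \<open>f\<close> is bounded, and \<open>monom 1 n\<close> has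
    norm \<open>sqrt (\<omega> n)\<close>, which is subexponential.\<close>
  have b_ev: "\<forall>\<^sub>F n in sequentially. b n \<le> exp (e * real n)" if e: "e > 0" for e
  proof -
    obtain D where D: "D \<ge> 0" "\<And>h. pnorm \<omega> (f * h) \<le> D * pnorm \<omega> h"
      using pnorm_mult_bounded[of \<omega> C f, OF pos ratio] by auto
    obtain C where C: "C > 0" "\<And>n. \<omega> n \<le> C * exp (e * real n)"
      by (rule weight_exp_bounds[OF w e]) (rule that)
    have monom: "pnorm \<omega> (monom 1 n) = sqrt (\<omega> n)" for n
    proof -
      have "(pnorm \<omega> (monom 1 n))\<^sup>2 = (\<Sum>k\<le>n. (cmod (coeff (monom 1 n) k))\<^sup>2 * \<omega> k)"
        by (rule pnorm_power2[of \<omega>, OF pos degree_monom_le])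
      also have "\<dots> = (\<Sum>k\<le>n. if k = n then \<omega> k else 0)"
        by (rule sum.cong) auto
      finally show ?thesis by (simp add: real_sqrt_unique)
    qed
    have "\<forall>\<^sub>F n in sequentially. D * sqrt (C * exp (e * real n)) / cmod (lead_coeff f) \<le> exp (e * real n)"
    proof -
      have "\<forall>\<^sub>F n in sequentially. D * sqrt (C * exp (e * real n)) / c \<le> exp (e * real n)"
        if "c > 0" for c
        using that D(1) C(1) e by real_asymp
      then show ?thesis using f by simp
    qed
    then show ?thesis
    proof eventually_elim
      case (elim n)
      have "pnorm \<omega> (f * monom 1 n) \<le> D * sqrt (\<omega> n)"
        using D(2)[of "monom 1 n"] by (simp only: monom)
      also have "\<dots> \<le> D * sqrt (C * exp (e * real n))"
        by (intro mult_left_mono real_sqrt_le_mono C(2) D(1))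
      finally have "b n \<le> D * sqrt (C * exp (e * real n)) / cmod (lead_coeff f)"
        unfolding b_def by (intro divide_right_mono) auto
      then show ?case using elim by linarith
    qed
  qed
  have freq: "\<exists>\<^sub>F n in sequentially. exp (- (1 / real (Suc j)) * real n) \<le> a n" for j
    by (rule frequently_large_increment[OF \<rho>_lim \<rho>_step _ \<rho>_ge b_ev]) (auto simp: a_def)
  \<comment> \<open>The rates \<open>1 / real (Suc j)\<close> shrink to 0 along the subsequence, so
    one choice of \<open>r\<close> serves every \<open>e\<close>.\<close>
  obtain r where r: "strict_mono r" "\<And>j. exp (- (1 / real (Suc j)) * real (r j)) \<le> a (r j)"
    by (rule frequently_diagonal_subseq
        [where P = "\<lambda>j n. exp (- (1 / real (Suc j)) * real n) \<le> a n", OF freq]) (rule that)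
  \<comment> \<open>Along \<open>r\<close> the coefficient at \<open>r k + d\<close> is nonzero,
    hence it is the leading one.\<close>
  have deg: "degree (R (r k)) = r k + d" for k
  proof (rule antisym[OF deg_R])
    have "a (r k) > 0" using r(2)[of k] by (rule less_le_trans[OF exp_gt_zero])
    then show "r k + d \<le> degree (R (r k))" by (intro le_degree) (simp add: a_def)
  qed
  have "weakly_converges (\<lambda>k. zero_measure (R (r k))) circle_measure"
  proof (rule zero_measure_weakly_converges, unfold deg)
    show "filterlim (\<lambda>k. r k + d) at_top sequentially"
      by (rule filterlim_at_top_mono[OF filterlim_subseq[OF r(1)]]) simp
  next
    fix e :: real assume e: "e > 0"
    have "\<forall>\<^sub>F k in sequentially. 1 / real (Suc k) < e" using e by real_asymp
    then show "\<forall>\<^sub>F k in sequentially. exp (- e * real (r k + d)) \<le> cmod (coeff (R (r k)) (r k + d))"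
    proof eventually_elim
      case (elim k)
      have "1 / real (Suc k) * real (r k) \<le> e * real (r k + d)"
        using elim e by (intro mult_mono) auto
      then have "exp (- e * real (r k + d)) \<le> exp (- (1 / real (Suc k)) * real (r k))"
        by simp
      also note r(2)[of k]
      finally show ?case by (simp add: a_def)
    qed
  next
    fix e :: real assume e: "e > 0"
    then have "e / 2 > 0" by simp
    \<comment> \<open>The constant coefficient is bounded below by the square of
      \<open>\<rho>\<close>, so the rate is halved.\<close>
    from eventually_subseq[OF r(1) \<rho>_ge[OF this]]
    show "\<forall>\<^sub>F k in sequentially. exp (- e * real (r k + d)) \<le> cmod (coeff (R (r k)) 0)"
    proof eventually_elim
      case (elim k)
      have "exp (- e * real (r k + d)) \<le> exp (- (e / 2) * real (r k)) ^ 2"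
        using e by (simp add: exp_double[symmetric] algebra_simps)
      also have "\<dots> \<le> (\<rho> (r k))\<^sup>2" using elim by (intro power_mono) auto
      also have "\<dots> \<le> Re (coeff (R (r k)) 0)"
        unfolding \<rho>_def R_def by (rule opa_const_coeff[of \<omega>, OF pos opa \<omega>0])
      also have "\<dots> \<le> cmod (coeff (R (r k)) 0)" by (rule complex_Re_le_cmod)
      finally show ?case .
    qed
  next
    fix e :: real assume e: "e > 0"
    then have "2 * e > 0" by simp
    from eventually_subseq[OF r(1) S_ev[OF this]]
    show "\<forall>\<^sub>F k in sequentially. \<forall>z. cmod z = 1 \<longrightarrow> cmod (poly (R (r k)) z) \<le> exp (e * real (r k + d))"
    proof eventually_elim
      case (elim k)
      show ?case
      proof (intro allI impI)
        fix z :: complex assume "cmod z = 1"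
        then have "cmod (poly (R (r k)) z) \<le> \<rho> (r k) * sqrt (S (r k + d))"
          unfolding \<rho>_def S_def by (rule cmod_poly_le_pnorm[OF pos deg_R])
        also have "\<dots> \<le> 1 * sqrt ((exp (e * real (r k)))\<^sup>2)"
          using elim S_pos by (intro mult_mono \<rho>_le) (auto simp: exp_double[symmetric] mult.assoc less_imp_le)
        also have "\<dots> \<le> exp (e * real (r k + d))" using e by simp
        finally show "cmod (poly (R (r k)) z) \<le> exp (e * real (r k + d))" .
      qed
    qed
  qed
  then show ?thesis using r(1) unfolding R_def by blast
qed

end
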